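(* Let $A(x,y)=\sum a_{m,n}x^my^n$ be the unique formal power series in $x,y$ with zero constant term satisfying $$A(x,y)=y+\frac{x}{2}\left[\frac{A(x,y)^2}{1-A(x,y)}+\frac{(1+A(x,y))\,A(x^2,y^2)}{1-A(x^2,y^2)}\right].$$ For $k\ge 3$ let $Z(D_k;s_1,s_2,\dots)$ be the cycle index of the dihedral group $D_k$ acting on the $k$ sides of a $k$-gon, namely $$Z(D_k)=\frac{1}{2k}\sum_{r\mid k}\varphi(r)s_r^{k/r}+\begin{cases}\frac14\left(s_1^2s_2^{\alpha-1}+s_2^{\alpha}\right), & k=2\alpha,\\ \frac12 s_1s_2^{\alpha}, & k=2\alpha+1,\end{cases}$$ ($\varphi$ Euler's totient) and let $Z(D_k,A(x,y))$ denote the result of substituting $s_r=A(x^r,y^r)$. Define $$B(x,y)=x\sum_{k\ge 3}Z(D_k,A(x,y)),\qquad C(x,y)=\tfrac12\left[(A(x,y)-y)^2-(A(x^2,y^2)-y^2)\right],$$ and $F(x,y)=B(x,y)-C(x,y)=\sum f_{m,n}x^my^n$. Then for $n\ge 2$ and $0\le k\le n-2$, the number of different classes of codimension $k$ faces of the associahedron $K_n$ is $f_{k+1,n+1}$.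
   Context: The associahedron $K_n$ is a convex polytope of dimension $n-2$ whose codimension $k$ faces correspond to the ways of placing $k$ pairwise non-crossing diagonals in a convex $(n+1)$-gon; the diagonals dissect the polygon into $k+1$ cells. For a dissected polygon $G$ and a diagonal $d$ of $G$, the twist of $G$ along $d$ is the dissected polygon obtained by cutting $G$ along $d$ into two pieces, reflecting one of the pieces, and gluing them back along $d$. Two dissected $(n+1)$-gons (faces of $K_n$) are of the same class if one can be obtained from the other by a combination of symmetries of the dihedral group $D_{n+1}$ of the polygon and twists along diagonals. *)

theory Defs
  imports
    "HOL-Computational_Algebra.Formal_Power_Series"
    "HOL-Number_Theory.Totient"
begin

unbundle fps_syntax

text \<open>
  The vertices of the convex \<open>N\<close>-gon are the residues \<open>0, \<dots>, N - 1\<close>, in cyclic order.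
  A segment between two vertices is the set of its two endpoints.
\<close>

definition diagonals :: "int \<Rightarrow> int set set" where
  "diagonals N = {{i, j} | i j. 0 \<le> i \<and> i + 2 \<le> j \<and> j < N \<and> (i, j) \<noteq> (0, N - 1)}"

definition crossing :: "int set \<Rightarrow> int set \<Rightarrow> bool" where
  "crossing d e \<longleftrightarrow>
     (\<exists>a b a' b'. a < a' \<and> a' < b \<and> b < b' \<and>
        (d = {a, b} \<and> e = {a', b'} \<or> e = {a, b} \<and> d = {a', b'}))"

definition dissection :: "int \<Rightarrow> int set set \<Rightarrow> bool" where
  "dissection N D \<longleftrightarrow> D \<subseteq> diagonals N \<and> (\<forall>d\<in>D. \<forall>e\<in>D. \<not> crossing d e)"

text \<open>
  A codimension \<open>k\<close> face of \<open>K\<^sub>n\<close> is identified with the dissection of the \<open>(n + 1)\<close>-gon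
  by \<open>k\<close> pairwise non-crossing diagonals to which it corresponds.
\<close>

definition associahedron_faces :: "nat \<Rightarrow> nat \<Rightarrow> int set set set" where
  "associahedron_faces n k = {D. dissection (int n + 1) D \<and> card D = k}"

text \<open>The vertices met when going around the polygon from \<open>i\<close> in positive direction up to \<open>j\<close>.\<close>

definition polygon_arc :: "int \<Rightarrow> int \<Rightarrow> int \<Rightarrow> int set" where
  "polygon_arc N i j = {v. 0 \<le> v \<and> v < N \<and> (v - i) mod N \<le> (j - i) mod N}"

text \<open>
  Cutting along the diagonal \<open>{i, j}\<close> gives the pieces with vertex sets \<open>polygon_arc N i j\<close> and
  \<open>polygon_arc N j i\<close>.  Reflecting the first one so that it can be glued back along \<open>{i, j}\<close>
  exchanges \<open>i\<close> and \<open>j\<close>, i.e. it is \<open>v \<mapsto> i + j - v\<close> modulo \<open>N\<close>.  Exchanging the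
  roles of \<open>i\<close> and \<open>j\<close> reflects the other piece.
\<close>

definition twist :: "int \<Rightarrow> int \<Rightarrow> int \<Rightarrow> int set set \<Rightarrow> int set set" where
  "twist N i j D =
     (\<lambda>e. if e \<subseteq> polygon_arc N i j then (\<lambda>v. (i + j - v) mod N) ` e else e) ` D"

definition dihedral_maps :: "int \<Rightarrow> (int \<Rightarrow> int) set" where
  "dihedral_maps N = {\<lambda>v. (c + v) mod N | c. True} \<union> {\<lambda>v. (c - v) mod N | c. True}"

inductive same_class :: "int \<Rightarrow> int set set \<Rightarrow> int set set \<Rightarrow> bool" for N where
  refl: "same_class N D D"
| symmetry: "same_class N D D' \<Longrightarrow> \<sigma> \<in> dihedral_maps N \<Longrightarrow>
    same_class N D ((\<lambda>d. \<sigma> ` d) ` D')"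
| twist: "same_class N D D' \<Longrightarrow> {i, j} \<in> D' \<Longrightarrow> same_class N D (twist N i j D')"

definition face_classes :: "nat \<Rightarrow> nat \<Rightarrow> int set set set set" where
  "face_classes n k =
     associahedron_faces n k //
       {(D, D'). D \<in> associahedron_faces n k \<and> D' \<in> associahedron_faces n k \<and>
                 same_class (int n + 1) D D'}"

text \<open>
  Power series in \<open>x\<close> whose coefficients are power series in \<open>y\<close>: the coefficient of
  \<open>x\<^sup>m y\<^sup>n\<close> in \<open>f\<close> is \<open>f $ m $ n\<close>.
\<close>

type_synonym fps2 = "rat fps fps"

definition var_x :: fps2 where "var_x = fps_X"

definition var_y :: fps2 where "var_y = fps_const fps_X"

definition const2 :: "rat \<Rightarrow> fps2" where "const2 c = fps_const (fps_const c)"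

text \<open>\<open>subst_pow r f\<close> is \<open>f(x\<^sup>r, y\<^sup>r)\<close>, for \<open>r \<ge> 1\<close>.\<close>

definition subst_pow :: "nat \<Rightarrow> fps2 \<Rightarrow> fps2" where
  "subst_pow r f = Abs_fps (\<lambda>m. (f $ m) oo (fps_X ^ r)) oo (fps_X ^ r)"

text \<open>
  Coefficientwise sum of a family in which every monomial occurs in only finitely many
  members.  (The sums below do not converge in the library's topology on \<open>fps2\<close>, which
  is the \<open>x\<close>-adic one.)
\<close>

definition formal_sum :: "nat set \<Rightarrow> (nat \<Rightarrow> fps2) \<Rightarrow> fps2" where
  "formal_sum K f =
     Abs_fps (\<lambda>m. Abs_fps (\<lambda>n. \<Sum>k | k \<in> K \<and> f k $ m $ n \<noteq> 0. f k $ m $ n))"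

definition A_equation :: "fps2 \<Rightarrow> bool" where
  "A_equation A \<longleftrightarrow>
     A = var_y + const2 (1/2) * var_x *
           (A\<^sup>2 / (1 - A) + (1 + A) * subst_pow 2 A / (1 - subst_pow 2 A))"

definition cycle_index_dihedral :: "nat \<Rightarrow> (nat \<Rightarrow> fps2) \<Rightarrow> fps2" where
  "cycle_index_dihedral k s =
     const2 (1 / (2 * of_nat k)) * (\<Sum>r | r dvd k. of_nat (totient r) * s r ^ (k div r)) +
     (if even k
      then const2 (1/4) * ((s 1)\<^sup>2 * s 2 ^ (k div 2 - 1) + s 2 ^ (k div 2))
      else const2 (1/2) * s 1 * s 2 ^ (k div 2))"

definition B_series :: "fps2 \<Rightarrow> fps2" where
  "B_series A =
     var_x * formal_sum {3..} (\<lambda>k. cycle_index_dihedral k (\<lambda>r. subst_pow r A))"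

definition C_series :: "fps2 \<Rightarrow> fps2" where
  "C_series A = const2 (1/2) * ((A - var_y)\<^sup>2 - (subst_pow 2 A - var_y\<^sup>2))"

definition F_series :: "fps2 \<Rightarrow> fps2" where
  "F_series A = B_series A - C_series A"

end

theory Submission
  imports Defs "HOL-Library.Countable" "HOL-Library.Product_Plus" "HOL-Library.Product_Lexorder"
begin

text \<open>
  A dissected polygon, up to symmetries and twists, is its dual tree: leaves are the sides of
  the polygon, inner nodes are the cells, and the neighbours of each cell carry a cyclic order
  up to reversal. Polya counting gives \<open>A\<close> for trees planted at an edge and \<open>B\<close> for
  trees rooted at a cell. Every tree is then counted once by the cells at which no neighbouring
  branch outweighs the rest: if the branch behind a diagonal is strictly larger, in a total
  order refining the number of nodes, than the remainder of the tree, the root is moved across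
  that diagonal. At most one branch of a root can be larger in this sense, so the cell rootings
  at which a move is possible correspond to the pairs of distinct planted trees joined along a
  diagonal, which are counted by \<open>C\<close>. The moves terminate and connect precisely the rootings
  of one tree, hence the unrooted trees are the immovable cell rootings, in number \<open>B - C\<close>.
\<close>

section \<open>Plane forests and noncrossing arcs\<close>

text \<open>A twist reflects a whole piece and so reverses the order at every cell of it. Following
  it by twists of the smaller pieces behind the first cell undoes all reversals but one; therefore
  the classes allow an independent reversal at each cell, and a normal form can be computed node by
  node. Faces are sets of diagonals of a polygon with numbered vertices, while a list of branches
  marks no vertex and singles out a cell. Hence lists are laid out from a variable offset, and the
  relation \<open>same_tree\<close> has to absorb both the offset and the choice of the root. The
  variable x counts cells and y counts sides: k diagonals make k + 1 cells, and the factor x in B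
  pays for the root cell, which \<open>nodes\<close> does not count. The series A also contains the
  single side y; a diagonal has inner nodes at both ends, which gives A - y in C, and A(x^2,y^2) -
  y^2 takes away the diagonals with equal trees at both ends, across which no move is possible. In
  this sense B - C is Otter's dissimilarity identity.\<close>

datatype ptree = Leaf | Node "ptree list"

instance ptree :: countable
  by countable_datatype

text \<open>
  All recursions run over forests, by first child and next sibling, so that a single list
  induction covers trees and forests alike.
\<close>

fun leaves :: "ptree list \<Rightarrow> nat" where
  "leaves [] = 0"
| "leaves (Leaf # ts) = Suc (leaves ts)"
| "leaves (Node us # ts) = leaves us + leaves ts"

fun nodes :: "ptree list \<Rightarrow> nat" where
  "nodes [] = 0"
| "nodes (Leaf # ts) = nodes ts"
| "nodes (Node us # ts) = Suc (nodes us + nodes ts)"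

text \<open>A cell has at least three sides, one of which is the diagonal towards the root; the
  remaining ones are the children.\<close>

fun valid :: "ptree list \<Rightarrow> bool" where
  "valid [] \<longleftrightarrow> True"
| "valid (Leaf # ts) \<longleftrightarrow> valid ts"
| "valid (Node us # ts) \<longleftrightarrow> 2 \<le> length us \<and> valid us \<and> valid ts"

text \<open>Geometric reflection: the order is reversed at every depth, unlike \<open>rev\<close>,
  which touches the top level only.\<close>

fun mirror :: "ptree list \<Rightarrow> ptree list" where
  "mirror [] = []"
| "mirror (Leaf # ts) = mirror ts @ [Leaf]"
| "mirror (Node us # ts) = mirror ts @ [Node (mirror us)]"

text \<open>
  The leaves of the forest are laid out as the segments \<open>[a, a + 1], [a + 1, a + 2], \<dots>\<close>; the
  pair \<open>(i, j)\<close> is the diagonal cutting off an inner node with leaves between \<open>i\<close> and \<open>j\<close>.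
\<close>

fun arcs :: "ptree list \<Rightarrow> int \<Rightarrow> (int \<times> int) set" where
  "arcs [] a = {}"
| "arcs (Leaf # ts) a = arcs ts (a + 1)"
| "arcs (Node us # ts) a =
     insert (a, a + int (leaves us)) (arcs us a \<union> arcs ts (a + int (leaves us)))"

lemma leaves_append [simp]: "leaves (xs @ ys) = leaves xs + leaves ys"
  by (induction xs rule: leaves.induct) auto

lemma nodes_append [simp]: "nodes (xs @ ys) = nodes xs + nodes ys"
  by (induction xs rule: nodes.induct) auto

lemma valid_append [simp]: "valid (xs @ ys) \<longleftrightarrow> valid xs \<and> valid ys"
  by (induction xs rule: valid.induct) auto

lemma mirror_append [simp]: "mirror (xs @ ys) = mirror ys @ mirror xs"
  by (induction xs rule: mirror.induct) auto

lemma length_mirror [simp]: "length (mirror xs) = length xs"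
  by (induction xs rule: mirror.induct) auto

lemma leaves_mirror [simp]: "leaves (mirror xs) = leaves xs"
  by (induction xs rule: mirror.induct) auto

lemma nodes_mirror [simp]: "nodes (mirror xs) = nodes xs"
  by (induction xs rule: mirror.induct) auto

lemma valid_mirror [simp]: "valid (mirror xs) \<longleftrightarrow> valid xs"
  by (induction xs rule: mirror.induct) auto

lemma mirror_mirror [simp]: "mirror (mirror xs) = xs"
  by (induction xs rule: mirror.induct) auto

lemma arcs_append: "arcs (xs @ ys) a = arcs xs a \<union> arcs ys (a + int (leaves xs))"
  by (induction xs a rule: arcs.induct) (auto simp: algebra_simps)

lemma arcs_shift: "arcs xs (a + c) = (\<lambda>(i, j). (i + c, j + c)) ` arcs xs a"
proof (induction xs a rule: arcs.induct)
  case (2 ts a)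
  then show ?case by (simp add: algebra_simps)
next
  case (3 us ts a)
  have "a + c + int (leaves us) = a + int (leaves us) + c" by simp
  then show ?case using 3 by (simp add: image_Un ac_simps)
qed simp

text \<open>Negation sends the interval from \<open>a\<close> to \<open>a + int (leaves xs)\<close>
  to one that starts at \<open>- a - int (leaves xs)\<close>, whence the new offset.\<close>

lemma arcs_mirror:
  "arcs (mirror xs) (- a - int (leaves xs)) = (\<lambda>(i, j). (- j, - i)) ` arcs xs a"
proof (induction xs a rule: arcs.induct)
  case (2 ts a)
  have e: "- a - int (leaves (Leaf # ts)) = - (a + 1) - int (leaves ts)" by simp
  show ?case unfolding e mirror.simps arcs_append 2 by simp
next
  case (3 us ts a)
  have e: "- a - int (leaves (Node us # ts)) = - (a + int (leaves us)) - int (leaves ts)"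
    and e': "- (a + int (leaves us)) = - a - int (leaves us)"
    by simp_all
  have u: "arcs [Node (mirror us)] (- a - int (leaves us)) = (\<lambda>(i, j). (- j, - i)) ` arcs [Node us] a"
    using 3(1) by simp
  show ?case unfolding e mirror.simps arcs_append 3(2) leaves_mirror
    using u by (simp add: e' image_Un Un_ac)
qed simp

lemma length_le_leaves: "valid xs \<Longrightarrow> length xs \<le> leaves xs"
  by (induction xs rule: valid.induct) auto

lemma arcs_bounds:
  "valid xs \<Longrightarrow> (i, j) \<in> arcs xs a \<Longrightarrow> a \<le> i \<and> i + 2 \<le> j \<and> j \<le> a + int (leaves xs)"
proof (induction xs a rule: arcs.induct)
  case (3 us ts a)
  with length_le_leaves[of us] show ?case by fastforce
qed auto

text \<open>Every arc stays inside the block of a single tree, and with two or more trees each block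
  misses a leaf. This keeps the arc of a node apart from those below it, and keeps the side (0, N -
  1) from appearing as a diagonal.\<close>

lemma arcs_not_whole:
  assumes "valid xs" "2 \<le> length xs"
  shows "(a, a + int (leaves xs)) \<notin> arcs xs a"
proof -
  from assms obtain x y ys where xs: "xs = x # y # ys"
    by (cases xs; cases "tl xs") auto
  from assms have "valid [x]" "valid (y # ys)"
    by (auto simp: xs) (metis append_Cons append_Nil valid_append)+
  moreover have "arcs xs a = arcs [x] a \<union> arcs (y # ys) (a + int (leaves [x]))"
    using arcs_append[of "[x]" "y # ys" a] by (simp add: xs)
  moreover have "leaves xs = leaves [x] + leaves (y # ys)"
    using leaves_append[of "[x]" "y # ys"] by (simp add: xs)
  moreover have "leaves [x] \<ge> 1" "leaves (y # ys) \<ge> 1"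
    using length_le_leaves[of "[x]"] length_le_leaves[of "y # ys"] calculation by auto
  ultimately show ?thesis
    using arcs_bounds[of "[x]" a "a + int (leaves xs)" a]
      arcs_bounds[of "y # ys" a "a + int (leaves xs)" "a + int (leaves [x])"] by auto
qed

lemma finite_arcs: "finite (arcs xs a)"
  by (induction xs a rule: arcs.induct) auto

text \<open>No two nodes share an arc: a node covers more leaves than anything below it, and
  siblings cover consecutive ranges.\<close>

lemma card_arcs: "valid xs \<Longrightarrow> card (arcs xs a) = nodes xs"
proof (induction xs a rule: arcs.induct)
  case (3 us ts a)
  have "(a, a + int (leaves us)) \<notin> arcs us a"
    using arcs_not_whole 3 by auto
  moreover have "(a, a + int (leaves us)) \<notin> arcs ts (a + int (leaves us))"
    using arcs_bounds[of ts a _ "a + int (leaves us)"] 3(3) length_le_leaves[of us] by fastforce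
  moreover have "arcs us a \<inter> arcs ts (a + int (leaves us)) = {}"
    using arcs_bounds[of us _ _ a] arcs_bounds[of ts _ _ "a + int (leaves us)"] 3(3) by fastforce
  ultimately show ?case using 3 by (simp add: finite_arcs card_Un_disjoint)
qed auto

definition crossing_arcs :: "int \<times> int \<Rightarrow> int \<times> int \<Rightarrow> bool" where
  "crossing_arcs p q \<longleftrightarrow> fst p < fst q \<and> fst q < snd p \<and> snd p < snd q"

lemma arcs_noncrossing:
  "valid xs \<Longrightarrow> p \<in> arcs xs a \<Longrightarrow> q \<in> arcs xs a \<Longrightarrow> \<not> crossing_arcs p q"
proof (induction xs a rule: arcs.induct)
  case (3 us ts a)
  have us: "a \<le> fst r \<and> fst r < snd r \<and> snd r \<le> a + int (leaves us)" if "r \<in> arcs us a" for r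
    using arcs_bounds[of us "fst r" "snd r" a] that 3(3) by auto
  have ts: "a + int (leaves us) \<le> fst r \<and> fst r < snd r" if "r \<in> arcs ts (a + int (leaves us))" for r
    using arcs_bounds[of ts "fst r" "snd r" "a + int (leaves us)"] that 3(3) by auto
  from 3 show ?case
    using us[of p] us[of q] ts[of p] ts[of q] by (auto simp: crossing_arcs_def)
qed auto

text \<open>If some arc starts at \<open>a\<close>, the longest one is the arc of the first tree;
  otherwise the first tree is a leaf. The other arcs belong to its children or to the later trees
  according to their position relative to its end.\<close>

lemma arcs_inject:
  "valid xs \<Longrightarrow> valid ys \<Longrightarrow> leaves xs = leaves ys \<Longrightarrow> arcs xs a = arcs ys a \<Longrightarrow> xs = ys"
proof (induction xs a arbitrary: ys rule: arcs.induct)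
  case (1 a)
  with length_le_leaves[of ys] show ?case by auto
next
  case (2 ts a)
  show ?case
  proof (cases "(ys, a)" rule: arcs.cases)
    case (2 zs b)
    with "2.prems" "2.IH" show ?thesis by auto
  next
    case (3 us zs b)
    then have "(a, a + int (leaves us)) \<in> arcs ts (a + 1)" using "2.prems" by auto
    then show ?thesis using arcs_bounds[of ts] "2.prems" by fastforce
  qed (use "2.prems" in auto)
next
  case (3 us ts a)
  have le: "leaves us \<le> leaves vs"
    if "valid (Node us # ts)" "valid (Node vs # zs)" "arcs (Node us # ts) a = arcs (Node vs # zs) a"
    for us ts vs zs
  proof -
    have "(a, a + int (leaves us)) \<in> arcs (Node vs # zs) a"
      using that(3)[symmetric] by simp
    moreover have "leaves vs > 0" using length_le_leaves[of vs] that by auto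
    ultimately show ?thesis
      using arcs_bounds[of vs a "a + int (leaves us)" a] that
        arcs_bounds[of zs a "a + int (leaves us)" "a + int (leaves vs)"] by auto
  qed
  have split: "arcs us a = {p \<in> arcs (Node us # ts) a. snd p \<le> a + int (leaves us)} - {(a, a + int (leaves us))}"
    "arcs ts (a + int (leaves us)) = {p \<in> arcs (Node us # ts) a. fst p \<ge> a + int (leaves us)}"
    if "valid (Node us # ts)" for us ts
  proof -
    have "(a, a + int (leaves us)) \<notin> arcs us a" using arcs_not_whole that by auto
    moreover have "leaves us > 0" using length_le_leaves[of us] that by auto
    ultimately show "arcs us a = {p \<in> arcs (Node us # ts) a. snd p \<le> a + int (leaves us)} - {(a, a + int (leaves us))}"
    "arcs ts (a + int (leaves us)) = {p \<in> arcs (Node us # ts) a. fst p \<ge> a + int (leaves us)}"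
      using arcs_bounds[of us _ _ a] arcs_bounds[of ts _ _ "a + int (leaves us)"] that
      by fastforce+
  qed
  show ?case
  proof (cases "(ys, a)" rule: arcs.cases)
    case 1
    with 3 length_le_leaves[of us] show ?thesis by auto
  next
    case (2 zs b)
    then have "(a, a + int (leaves us)) \<in> arcs zs (a + 1)" using "3.prems" by auto
    then show ?thesis using arcs_bounds[of zs] "3.prems" 2 by fastforce
  next
    case (3 vs zs b)
    then have ys: "ys = Node vs # zs" by simp
    have l: "leaves us = leaves vs"
      using le[of us ts vs zs] le[of vs zs us ts] "3.prems" unfolding ys by force
    have v: "valid us" "valid ts" "valid vs" "valid zs" "leaves ts = leaves zs"
      using "3.prems"(1-3) l unfolding ys by simp_all
    have eq: "arcs (Node us # ts) a = arcs (Node vs # zs) a" using "3.prems"(4) by (simp add: ys)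
    have w: "valid (Node us # ts)" "valid (Node vs # zs)" using "3.prems" by (simp_all add: ys)
    have "arcs us a = arcs vs a"
      by (simp only: split(1)[OF w(1)] split(1)[OF w(2)] eq l)
    moreover have "arcs ts (a + int (leaves us)) = arcs zs (a + int (leaves us))"
      by (simp only: split(2)[OF w(1)] split(2)[OF w(2), folded l] eq)
    ultimately have "us = vs" "ts = zs" using "3.IH" v l by blast+
    then show ?thesis by (simp add: ys)
  qed
qed

text \<open>Induction on \<open>b - a\<close>. If the outer arc (a, b) is absent, the interval can
  be cut at a point that no arc straddles: the end of the longest arc from \<open>a\<close>, or
  \<open>a + 1\<close> if there is none. If (a, b) is present, it becomes a node around the forest
  of the other arcs.\<close>

lemma arcs_exists:
  assumes "a \<le> b"
    and "\<And>i j. (i, j) \<in> S \<Longrightarrow> a \<le> i \<and> i + 2 \<le> j \<and> j \<le> b"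
    and "\<And>p q. p \<in> S \<Longrightarrow> q \<in> S \<Longrightarrow> \<not> crossing_arcs p q"
  shows "\<exists>xs. valid xs \<and> int (leaves xs) = b - a \<and> arcs xs a = S"
  using assms
proof (induction "nat (b - a)" arbitrary: a b S rule: less_induct)
  case less
  have cut: "\<exists>xs. valid xs \<and> int (leaves xs) = b - a \<and> arcs xs a = S'"
    if S': "S' \<subseteq> S" "(a, b) \<notin> S'" and "a < b" for S'
  proof -
    have bnd: "a \<le> i \<and> i + 2 \<le> j \<and> j \<le> b" if "(i, j) \<in> S'" for i j
      using that S' less.prems(2) by blast
    define M where "M = {j. (a, j) \<in> S'}"
    define m where "m = (if M = {} then a + 1 else Max M)"
    have "M \<subseteq> {a..b}" unfolding M_def using bnd by force
    then have fin: "finite M" by (rule finite_subset) simp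
    have am: "a < m" "m \<le> b" and inM: "M \<noteq> {} \<Longrightarrow> (a, m) \<in> S'"
      using fin Max_in[of M] bnd \<open>a < b\<close> by (force simp: m_def M_def)+
    show ?thesis
    proof (cases "m = b")
      case True
      then have "M = {}" "b = a + 1" using inM S' by (auto simp: m_def split: if_splits)
      then have "S' = {}" using bnd by fastforce
      then show ?thesis using \<open>b = a + 1\<close> by (intro exI[of _ "[Leaf]"]) simp
    next
      case False
      define S1 where "S1 = {p \<in> S'. snd p \<le> m}"
      define S2 where "S2 = {p \<in> S'. m \<le> fst p}"
      \<comment> \<open>An arc from \<open>a\<close> is no longer than the longest one, and an arc
        that starts strictly between \<open>a\<close> and \<open>m\<close> and ends beyond
        \<open>m\<close> would cross (a, m).\<close>
      have "j \<le> m \<or> m \<le> i" if p: "(i, j) \<in> S'" for i j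
      proof (rule ccontr)
        assume c: "\<not> ?thesis"
        show False
        proof (cases "M = {}")
          case True
          then have "i \<noteq> a" using p by (auto simp: M_def)
          then show ?thesis using True c bnd[OF p] by (simp add: m_def)
        next
          case False
          have "i = a \<Longrightarrow> j \<le> m"
            using p fin Max_ge[of M j] False by (auto simp: m_def M_def)
          then have "crossing_arcs (a, m) (i, j)"
            using c bnd[OF p] by (cases "i = a") (auto simp: crossing_arcs_def)
          then show ?thesis using less.prems(3) inM[OF False] p S' by blast
        qed
      qed
      then have S'_eq: "S' = S1 \<union> S2" by (force simp: S1_def S2_def)
      have nc: "\<not> crossing_arcs p q" if "p \<in> S'" "q \<in> S'" for p q
        using that S'(1) less.prems(3) by blast
      have "\<exists>xs. valid xs \<and> int (leaves xs) = m - a \<and> arcs xs a = S1"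
        by (rule less.hyps) (use am False bnd nc in \<open>auto simp: S1_def\<close>)
      then obtain xs where xs: "valid xs" "int (leaves xs) = m - a" "arcs xs a = S1"
        by blast
      have "\<exists>ys. valid ys \<and> int (leaves ys) = b - m \<and> arcs ys m = S2"
        by (rule less.hyps) (use am False bnd nc in \<open>auto simp: S2_def\<close>)
      then obtain ys where ys: "valid ys" "int (leaves ys) = b - m" "arcs ys m = S2"
        by blast
      show ?thesis
        by (intro exI[of _ "xs @ ys"]) (use xs ys S'_eq in \<open>simp add: arcs_append\<close>)
    qed
  qed
  show ?case
  proof (cases "(a, b) \<in> S")
    case True
    then have ab: "a + 2 \<le> b" using less.prems(2) by blast
    then obtain xs where xs: "valid xs" "int (leaves xs) = b - a" "arcs xs a = S - {(a, b)}"
      using cut[of "S - {(a, b)}"] by auto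
    \<comment> \<open>Fewer than two trees would cover at most one leaf or contribute the arc (a,
      b), which has been removed.\<close>
    have "2 \<le> length xs"
    proof (rule ccontr)
      assume "\<not> ?thesis"
      then have "length xs = 0 \<or> length xs = 1" by linarith
      then consider "xs = []" | "xs = [Leaf]" | us where "xs = [Node us]"
        by (auto simp: length_Suc_conv) (metis ptree.exhaust)
      then show False using xs ab by cases auto
    qed
    with xs True show ?thesis
      by (intro exI[of _ "[Node xs]"]) auto
  next
    case False
    show ?thesis
    proof (cases "a = b")
      case True
      then have "S = {}" using less.prems(2) by fastforce
      then show ?thesis using True by (intro exI[of _ "[]"]) simp
    next
      case f: False
      then show ?thesis using cut[of S] False less.prems(1) by auto
    qed
  qed
qed

section \<open>Dissections as cyclic forests\<close>

text \<open>
  A list of at least three trees is also read cyclically, as the branches around one cell of a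
  dissection. Then \<open>Node us # ps\<close> and \<open>us @ [Node ps]\<close> describe the same dissection
  from the two sides of the diagonal that cuts off \<open>Node us\<close>.
\<close>

definition cell :: "ptree list \<Rightarrow> bool" where
  "cell xs \<longleftrightarrow> valid xs \<and> 3 \<le> length xs"

text \<open>\<open>move\<close> changes nothing but the root cell; its length conditions make the
  new node have at least two children and the new root cell at least three branches.
  \<open>twist\<close> is stated for the first branch alone, since \<open>rot\<close> and
  \<open>move\<close> bring any inner node there.\<close>

inductive same_tree :: "ptree list \<Rightarrow> ptree list \<Rightarrow> bool" where
  refl: "same_tree xs xs"
| sym: "same_tree xs ys \<Longrightarrow> same_tree ys xs"
| trans: "same_tree xs ys \<Longrightarrow> same_tree ys zs \<Longrightarrow> same_tree xs zs"
| rot: "same_tree (xs @ ys) (ys @ xs)"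
| flip: "same_tree xs (mirror xs)"
| move: "2 \<le> length us \<Longrightarrow> 2 \<le> length ps \<Longrightarrow> same_tree (Node us # ps) (us @ [Node ps])"
| twist: "same_tree (Node us # ps) (Node (mirror us) # ps)"

lemma same_tree_invariants:
  "same_tree xs ys \<Longrightarrow> leaves xs = leaves ys \<and> nodes xs = nodes ys \<and> (cell xs \<longleftrightarrow> cell ys)"
  by (induction rule: same_tree.induct) (auto simp: cell_def)

definition chord :: "int \<Rightarrow> int \<times> int \<Rightarrow> int set" where
  "chord N p = {fst p mod N, snd p mod N}"

text \<open>The offset \<open>a\<close> is the vertex at which the first leaf begins; it supplies
  the marked vertex that a list of branches lacks.\<close>

definition chords :: "int \<Rightarrow> int \<Rightarrow> ptree list \<Rightarrow> int set set" where
  "chords N a xs = chord N ` arcs xs a"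

lemma chords_append: "chords N a (xs @ ys) = chords N a xs \<union> chords N (a + int (leaves xs)) ys"
  by (simp add: chords_def arcs_append image_Un)

lemma chords_Node_Cons:
  "chords N a (Node us # ts) = 
     insert {a mod N, (a + int (leaves us)) mod N} (chords N a us \<union> chords N (a + int (leaves us)) ts)"
  by (simp add: chords_def image_Un chord_def)

lemma chords_Nil [simp]: "chords N a [] = {}"
  by (simp add: chords_def)

lemma chords_rotate:
  "(\<lambda>d. (\<lambda>v. (c + v) mod N) ` d) ` chords N a xs = chords N (a + c) xs"
  unfolding chords_def arcs_shift image_image chord_def
  by (rule image_cong[OF HOL.refl]) (auto simp: mod_simps add.commute)

lemma chords_reflect:
  "(\<lambda>d. (\<lambda>v. (c - v) mod N) ` d) ` chords N a xs = chords N (c - a - int (leaves xs)) (mirror xs)"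
proof -
  have "c - a - int (leaves xs) = - a - int (leaves xs) + c" by simp
  then show ?thesis
    unfolding chords_def arcs_shift arcs_mirror image_image chord_def
    by (simp only: arcs_shift arcs_mirror image_image)
      (rule image_cong[OF HOL.refl], auto simp: mod_simps)
qed

lemma chords_period: "chords N (a + N * t) xs = chords N a xs"
  unfolding chords_def arcs_shift image_image chord_def
  by (rule image_cong[OF HOL.refl]) auto

lemma chords_cong_mod: "a mod N = b mod N \<Longrightarrow> chords N a xs = chords N b xs"
  by (metis chords_period mod_div_mult_eq mult.commute)

lemma chords_rot:
  "N = int (leaves xs + leaves ys) \<Longrightarrow>
    chords N a (xs @ ys) = chords N (a + int (leaves xs)) (ys @ xs)"
  using chords_period[of N a 1 xs] by (simp add: chords_append Un_commute algebra_simps)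

text \<open>The two nodes have the arcs from \<open>a\<close> to \<open>a + int (leaves us)\<close>
  and from there to \<open>a + N\<close>: modulo \<open>N\<close> this is one diagonal with its ends
  exchanged.\<close>

lemma chords_move:
  "N = int (leaves us + leaves ps) \<Longrightarrow> chords N a (Node us # ps) = chords N a (us @ [Node ps])"
  by (simp add: chords_append chords_Node_Cons algebra_simps insert_commute)

text \<open>Moving the root into the last branch, as long as this is an inner node, ends at a side of the polygon.\<close>

lemma ex_last_Leaf:
  assumes "cell xs"
  shows "\<exists>ts. same_tree xs (ts @ [Leaf]) \<and>
    (\<forall>a. chords (int (leaves xs)) a xs = chords (int (leaves xs)) a (ts @ [Leaf]))"
  using assms
proof (induction "nodes [last xs]" arbitrary: xs rule: less_induct)
  case less
  then have "xs \<noteq> []" by (auto simp: cell_def)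
  then obtain zs x where xs: "xs = zs @ [x]" by (metis append_butlast_last_id)
  show ?case
  proof (cases x)
    case Leaf
    then show ?thesis using same_tree.refl xs by blast
  next
    case (Node us)
    have len: "2 \<le> length zs" "2 \<le> length us" using less.prems by (auto simp: xs Node cell_def)
    then have m: "same_tree (Node zs # us) xs" unfolding xs Node by (rule same_tree.move)
    have us: "us = butlast us @ [last us]" using len by (cases us rule: rev_cases) auto
    have "nodes [last (Node zs # us)] < nodes [last xs]"
      using arg_cong[OF us, of nodes] len by (auto simp: xs Node)
    with less.hyps[of "Node zs # us"] m less.prems obtain ts where
      ts: "same_tree (Node zs # us) (ts @ [Leaf])"
        "\<forall>a. chords (int (leaves (Node zs # us))) a (Node zs # us) = chords (int (leaves (Node zs # us))) a (ts @ [Leaf])"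
      using same_tree_invariants by blast
    have "same_tree xs (ts @ [Leaf])"
      using m ts(1) same_tree.sym same_tree.trans by blast
    moreover have "chords (int (leaves xs)) a xs = chords (int (leaves xs)) a (ts @ [Leaf])" for a
      using chords_move[of "int (leaves xs)" zs us a] ts(2) by (simp add: xs Node)
    ultimately show ?thesis by blast
  qed
qed

text \<open>Rotating the polygon changes the offset, whereas \<open>same_tree\<close> is to be
  compared at a fixed one. Every offset is reachable because a leaf at the end of the list can be
  put in front, which lowers the offset by one and keeps the chords.\<close>

lemma ex_chords_offset:
  assumes "cell xs"
  shows "\<exists>ys. same_tree xs ys \<and> chords (int (leaves xs)) b ys = chords (int (leaves xs)) a xs"
proof -
  let ?N = "int (leaves xs)"
  have "\<exists>ys. same_tree xs ys \<and> chords ?N (a - int t) ys = chords ?N a xs" for t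
  proof (induction t)
    case 0
    then show ?case using same_tree.refl by auto
  next
    case (Suc t)
    then obtain ys where ys: "same_tree xs ys" "chords ?N (a - int t) ys = chords ?N a xs" by blast
    then have ysN: "leaves ys = leaves xs" and "cell ys"
      using same_tree_invariants assms by auto
    from ex_last_Leaf[OF this(2)] obtain ts where
      ts: "same_tree ys (ts @ [Leaf])" "\<forall>a. chords ?N a ys = chords ?N a (ts @ [Leaf])"
      using ysN by auto
    have "?N = int (leaves [Leaf] + leaves ts)"
      using same_tree_invariants[OF ts(1)] ysN by simp
    from chords_rot[OF this, of "a - int (Suc t)"]
    have "chords ?N (a - int (Suc t)) ([Leaf] @ ts) = chords ?N a xs"
      using ts(2) ys(2) by simp
    moreover have "same_tree xs ([Leaf] @ ts)"
      using ys(1) ts(1) same_tree.rot same_tree.trans by blast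
    ultimately show ?case by blast
  qed
  \<comment> \<open>This number of steps takes \<open>a\<close> to a vertex congruent to
    \<open>b\<close>.\<close>
  from this[of "nat ((a - b) mod ?N)"] obtain ys where
    "same_tree xs ys" "chords ?N (a - int (nat ((a - b) mod ?N))) ys = chords ?N a xs" by blast
  moreover have "?N > 0" using assms length_le_leaves[of xs] by (auto simp: cell_def)
  then have "(a - int (nat ((a - b) mod ?N))) mod ?N = b mod ?N" by (simp add: mod_simps)
  ultimately show ?thesis using chords_cong_mod by metis
qed

text \<open>Brings an arbitrary diagonal to the front, where the rule \<open>twist\<close> of
  \<open>same_tree\<close> applies. Branches already passed accumulate in \<open>cs\<close>; on
  descending into a node, the rest of the cell is folded into one branch.\<close>

lemma ex_chord_first:
  assumes "(i, j) \<in> arcs xs a" "cell (xs @ cs)" "N = int (leaves (xs @ cs))"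
  shows "\<exists>us ps. same_tree (xs @ cs) (Node us # ps) \<and>
    chords N a (xs @ cs) = chords N i (Node us # ps) \<and> j = i + int (leaves us)"
  using assms
proof (induction xs a arbitrary: cs rule: arcs.induct)
  case (2 ts a)
  have "\<exists>us ps. same_tree (ts @ (cs @ [Leaf])) (Node us # ps) \<and>
    chords N (a + 1) (ts @ (cs @ [Leaf])) = chords N i (Node us # ps) \<and> j = i + int (leaves us)"
    using "2.prems" by (intro "2.IH") (auto simp: cell_def)
  moreover have "same_tree ((Leaf # ts) @ cs) (ts @ (cs @ [Leaf]))"
    using same_tree.rot[of "[Leaf]" "ts @ cs"] by simp
  moreover have "chords N a ((Leaf # ts) @ cs) = chords N (a + 1) (ts @ (cs @ [Leaf]))"
    using chords_rot[of N "[Leaf]" "ts @ cs" a] "2.prems" by simp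
  ultimately show ?case using same_tree.trans by metis
next
  case (3 us ts a)
  consider "(i, j) = (a, a + int (leaves us))" | "(i, j) \<in> arcs us a" |
    "(i, j) \<in> arcs ts (a + int (leaves us))" using "3.prems"(1) by auto
  then show ?case
  proof cases
    case 1
    then show ?thesis using same_tree.refl[of "Node us # ts @ cs"] by auto
  next
    case 2
    have len: "2 \<le> length us" "2 \<le> length (ts @ cs)" using "3.prems" by (auto simp: cell_def)
    then have "\<exists>us' ps. same_tree (us @ [Node (ts @ cs)]) (Node us' # ps) \<and>
      chords N a (us @ [Node (ts @ cs)]) = chords N i (Node us' # ps) \<and> j = i + int (leaves us')"
      using "3.prems" 2 by (intro "3.IH") (auto simp: cell_def)
    moreover have "same_tree ((Node us # ts) @ cs) (us @ [Node (ts @ cs)])"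
      using same_tree.move[OF len] by simp
    moreover have "chords N a ((Node us # ts) @ cs) = chords N a (us @ [Node (ts @ cs)])"
      using chords_move[of N us "ts @ cs" a] "3.prems" by simp
    ultimately show ?thesis using same_tree.trans by metis
  next
    case 3
    have "\<exists>us' ps. same_tree (ts @ (cs @ [Node us])) (Node us' # ps) \<and>
      chords N (a + int (leaves us)) (ts @ (cs @ [Node us])) = chords N i (Node us' # ps) \<and> j = i + int (leaves us')"
      using "3.prems" 3 by (intro "3.IH") (auto simp: cell_def)
    moreover have "same_tree ((Node us # ts) @ cs) (ts @ (cs @ [Node us]))"
      using same_tree.rot[of "[Node us]" "ts @ cs"] by simp
    moreover have "chords N a ((Node us # ts) @ cs) = chords N (a + int (leaves us)) (ts @ (cs @ [Node us]))"
      using chords_rot[of N "[Node us]" "ts @ cs" a] "3.prems" by simp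
    ultimately show ?thesis using same_tree.trans by metis
  qed
qed simp

text \<open>A chord lies in the reflected piece exactly if both ends are at most
  \<open>leaves us\<close> steps after \<open>i\<close>. This selects the arcs of \<open>us\<close>
  and the dividing diagonal, which the reflection maps to itself, and spares the arcs of
  \<open>ps\<close>.\<close>

lemma twist_chords:
  assumes "cell (Node us # ps)" and N: "N = int (leaves (Node us # ps))"
    and j: "j = i + int (leaves us)"
  shows "Defs.twist N (i mod N) (j mod N) (chords N i (Node us # ps)) = chords N i (Node (mirror us) # ps)"
proof -
  have v: "valid us" "valid ps" "2 \<le> length us" "2 \<le> length ps"
    using assms(1) by (auto simp: cell_def)
  then have pos: "2 \<le> leaves us" "2 \<le> leaves ps" using length_le_leaves[of us] length_le_leaves[of ps] by auto
  have "N > 0" using N pos by simp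
  have arc: "chord N (p, q) \<subseteq> polygon_arc N (i mod N) (j mod N) \<longleftrightarrow>
    (p - i) mod N \<le> int (leaves us) \<and> (q - i) mod N \<le> int (leaves us)" for p q
  proof -
    have "(j - i) mod N = int (leaves us)" using j N pos by simp
    then show ?thesis using \<open>N > 0\<close> by (simp add: chord_def polygon_arc_def mod_simps)
  qed
  let ?tw = "\<lambda>e. if e \<subseteq> polygon_arc N (i mod N) (j mod N) then (\<lambda>v. (i mod N + j mod N - v) mod N) ` e else e"
  have refl: "(\<lambda>v. (i mod N + j mod N - v) mod N) ` chord N (p, q) = chord N (i + j - q, i + j - p)" for p q
  proof -
    have "(i mod N + j mod N - v mod N) mod N = (i + j - v) mod N" for v
      by (rule mod_diff_cong[OF mod_add_cong]) simp_all
    then show ?thesis by (simp add: chord_def insert_commute)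
  qed
  have in_us: "?tw (chord N (p, q)) = chord N (i + j - q, i + j - p)" if "(p, q) \<in> arcs us i" for p q
  proof -
    have "i \<le> p" "p \<le> j" "i \<le> q" "q \<le> j" using arcs_bounds[OF v(1) that] j by auto
    then have "(p - i) mod N = p - i" "(q - i) mod N = q - i" using j N pos by auto
    with \<open>p \<le> j\<close> \<open>q \<le> j\<close> have "chord N (p, q) \<subseteq> polygon_arc N (i mod N) (j mod N)"
      unfolding arc using j by simp
    then show ?thesis using refl by simp
  qed
  have top: "?tw (chord N (i, j)) = chord N (i, j)"
    using refl[of i j] arc[of i j] j N pos by simp
  have in_ps: "?tw (chord N (p, q)) = chord N (p, q)" if "(p, q) \<in> arcs ps j" for p q
  proof -
    have b: "j \<le> p" "p + 2 \<le> q" "q \<le> i + N" using arcs_bounds[OF v(2) that] j N by auto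
    \<comment> \<open>Both ends of an arc of \<open>ps\<close> lie on the reflected piece only if
      they are \<open>j\<close> and \<open>i + N\<close>, but then the arc spans all of
      \<open>ps\<close>.\<close>
    have "\<not> chord N (p, q) \<subseteq> polygon_arc N (i mod N) (j mod N)"
    proof
      assume "chord N (p, q) \<subseteq> polygon_arc N (i mod N) (j mod N)"
      then have "(p - i) mod N \<le> int (leaves us)" "(q - i) mod N \<le> int (leaves us)" 
        using arc by auto
      moreover have "(p - i) mod N = p - i" using b j pos by simp
      moreover have "q < i + N \<Longrightarrow> (q - i) mod N = q - i" using b j pos by simp
      ultimately have "p = j" "q = i + N" using b j by linarith+
      then have "q = j + int (leaves ps)" using j N by simp
      with \<open>p = j\<close> show False using arcs_not_whole[OF v(2,4), of j] that by simp
    qed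
    then show ?thesis by simp
  qed
  \<comment> \<open>The reflection used by the twist maps the interval from \<open>i\<close> to
    \<open>j\<close> onto itself, so the mirrored forest starts at \<open>i\<close> again.\<close>
  have mir: "arcs (mirror us) i = (\<lambda>(p, q). (i + j - q, i + j - p)) ` arcs us i"
    using arcs_shift[of "mirror us" "- i - int (leaves us)" "i + j"] arcs_mirror[of us i] j
    by (simp add: image_image case_prod_unfold algebra_simps)
  have "?tw ` chords N i (Node us # ps) = 
    insert (?tw (chord N (i, j))) ((\<lambda>p. ?tw (chord N p)) ` arcs us i \<union> (\<lambda>p. ?tw (chord N p)) ` arcs ps j)"
    by (simp only: chords_def arcs.simps j image_insert image_Un image_image)
  also have "(\<lambda>p. ?tw (chord N p)) ` arcs us i = chord N ` arcs (mirror us) i"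
    unfolding mir image_image
  proof (rule image_cong[OF HOL.refl])
    fix r assume "r \<in> arcs us i"
    with in_us[of "fst r" "snd r"]
    show "?tw (chord N r) = chord N (case r of (p, q) \<Rightarrow> (i + j - q, i + j - p))"
      by (simp only: case_prod_unfold prod.collapse)
  qed
  also have "(\<lambda>p. ?tw (chord N p)) ` arcs ps j = chord N ` arcs ps j"
  proof (rule image_cong[OF HOL.refl])
    fix r assume "r \<in> arcs ps j"
    with in_ps[of "fst r" "snd r"] show "?tw (chord N r) = chord N r"
      by (simp only: prod.collapse)
  qed
  also have "?tw (chord N (i, j)) = chord N (i, j)" by (rule top)
  finally show ?thesis by (simp add: Defs.twist_def chords_def image_Un j)
qed


section \<open>Classes of dissections and equivalence of cyclic forests\<close>

lemma same_class_trans: "same_class N D' D'' \<Longrightarrow> same_class N D D' \<Longrightarrow> same_class N D D''"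
  by (induction rule: same_class.induct) (auto intro: same_class.intros)

lemma same_class_chords_offset: "same_class N (chords N a xs) (chords N b xs)"
proof -
  have "(\<lambda>v. (b - a + v) mod N) \<in> dihedral_maps N" by (auto simp: dihedral_maps_def)
  from same_class.symmetry[OF same_class.refl this, of "chords N a xs"]
  show ?thesis by (simp add: chords_rotate)
qed

lemma same_class_chords_mirror: "same_class N (chords N a xs) (chords N b (mirror xs))"
proof -
  have "(\<lambda>v. (b + a + int (leaves xs) - v) mod N) \<in> dihedral_maps N" by (auto simp: dihedral_maps_def)
  from same_class.symmetry[OF same_class.refl this, of "chords N a xs"]
  show ?thesis by (simp add: chords_reflect)
qed

lemma same_class_chords_twist:
  assumes "cell (Node us # ps)" "N = int (leaves (Node us # ps))"
  shows "same_class N (chords N a (Node us # ps)) (chords N a (Node (mirror us) # ps))"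
proof -
  have "{a mod N, (a + int (leaves us)) mod N} \<in> chords N a (Node us # ps)"
    by (simp add: chords_Node_Cons)
  from same_class.twist[OF same_class.refl this, of N] show ?thesis
    unfolding twist_chords[OF assms HOL.refl] .
qed

text \<open>Both directions go through the induction together, because \<open>sym\<close> asks for
  the converse and \<open>same_class\<close> has no such rule.\<close>

lemma same_tree_imp_same_class:
  assumes "same_tree xs ys" "cell xs" "N = int (leaves xs)"
  shows "same_class N (chords N 0 xs) (chords N 0 ys) \<and> same_class N (chords N 0 ys) (chords N 0 xs)"
  using assms
proof (induction rule: same_tree.induct)
  case (refl xs)
  then show ?case by (simp add: same_class.refl)
next
  case (sym xs ys)
  then show ?case using same_tree_invariants by metis
next
  case (trans xs ys zs)
  then show ?case using same_tree_invariants same_class_trans by metis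
next
  case (rot xs ys)
  then have "chords N 0 (xs @ ys) = chords N (int (leaves xs)) (ys @ xs)"
    using chords_rot[of N xs ys 0] by simp
  then show ?case using same_class_chords_offset by simp
next
  case (flip xs)
  then show ?case
    using same_class_chords_mirror[of N 0 xs 0] same_class_chords_mirror[of N 0 "mirror xs" 0] by simp
next
  case (move us ps)
  then show ?case using chords_move[of N us ps 0] by (simp add: same_class.refl)
next
  case (twist us ps)
  then show ?case
    using same_class_chords_twist[of us ps N 0] same_class_chords_twist[of "mirror us" ps N 0]
    by (simp add: cell_def)
qed

text \<open>The invariant is that each dissection reached is the chord set, at offset 0, of a list
  equivalent to \<open>xs\<close>. Every step of \<open>same_class\<close> may disturb the offset,
  and \<open>ex_chords_offset\<close> restores it.\<close>

lemma same_class_imp_same_tree: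
  assumes "same_class N D D'" "D = chords N 0 xs" "cell xs" "N = int (leaves xs)"
  shows "\<exists>ys. same_tree xs ys \<and> D' = chords N 0 ys"
  using assms
proof (induction rule: same_class.induct)
  case (refl D)
  then show ?case using same_tree.refl by blast
next
  case (symmetry D D' \<sigma>)
  then obtain ys where ys: "same_tree xs ys" "D' = chords N 0 ys" by blast
  then have "cell ys" "N = int (leaves ys)" "cell (mirror ys)" "N = int (leaves (mirror ys))"
    using same_tree_invariants symmetry.prems by (auto simp: cell_def)
  note ex = ex_chords_offset[OF this(1), of 0, folded this(2)]
    ex_chords_offset[OF this(3), of 0, folded this(4)]
  from symmetry.hyps(2) consider c where "\<sigma> = (\<lambda>v. (c + v) mod N)" | c where "\<sigma> = (\<lambda>v. (c - v) mod N)"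
    by (auto simp: dihedral_maps_def)
  then show ?case
  proof cases
    case 1
    then show ?thesis using ex(1)[of c] ys(1) same_tree.trans
      unfolding 1 ys(2) chords_rotate by simp metis
  next
    case 2
    have "same_tree xs (mirror ys)" using ys(1) same_tree.trans same_tree.flip by blast
    then show ?thesis using ex(2)[of "c - 0 - int (leaves ys)"] same_tree.trans
      unfolding 2 ys(2) chords_reflect by metis
  qed
next
  case (twist D D' i j)
  then obtain ys where ys: "same_tree xs ys" "D' = chords N 0 ys" by blast
  then have cell: "cell ys" "N = int (leaves ys)"
    using same_tree_invariants twist.prems by auto
  from twist.hyps(2) ys(2) obtain p q where pq: "(p, q) \<in> arcs ys 0" "{i, j} = {p mod N, q mod N}"
    by (auto simp: chords_def chord_def)
  from ex_chord_first[of p q ys 0 "[]" N] pq(1) cell obtain us ps where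
    us: "same_tree ys (Node us # ps)" "D' = chords N p (Node us # ps)" "q = p + int (leaves us)"
    unfolding ys(2) by auto
  then have c: "cell (Node us # ps)" and N: "N = int (leaves (Node us # ps))"
    using same_tree_invariants cell by metis+
  have len: "2 \<le> length us" "2 \<le> length ps" using c by (auto simp: cell_def)
  have xs: "same_tree xs (Node us # ps)" using us(1) ys(1) same_tree.trans by blast
  have off: "\<exists>ys. same_tree xs ys \<and> chords N a zs = chords N 0 ys" if "same_tree xs zs" for a zs
    using that same_tree_invariants[OF that] ex_chords_offset[of zs 0 a] twist.prems same_tree.trans
    by metis
  from pq(2) consider "i = p mod N" "j = q mod N" | "i = q mod N" "j = p mod N"
    by (auto simp: doubleton_eq_iff)
  then show ?case
  proof cases
    case 1
    have "Defs.twist N i j D' = chords N p (Node (mirror us) # ps)"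
      unfolding 1 us(2) using twist_chords[OF c N us(3)] .
    moreover have "same_tree xs (Node (mirror us) # ps)"
      using xs same_tree.twist same_tree.trans by blast
    ultimately show ?thesis using off by simp
  next
    case 2
    \<comment> \<open>With the ends exchanged it is the other piece that is reflected, so the root
      is first moved across the diagonal to make \<open>ps\<close> the first branch.\<close>
    have "D' = chords N q (Node ps # us)"
      using us(2,3) chords_move[of N us ps p] chords_rot[of N us "[Node ps]" p] N by simp
    moreover have "cell (Node ps # us)" "N = int (leaves (Node ps # us))"
      using c N len by (auto simp: cell_def)
    moreover have "q + int (leaves ps) = p + N" using us(3) N by simp
    then have "p mod N = (q + int (leaves ps)) mod N" by simp
    ultimately have "Defs.twist N i j D' = chords N q (Node (mirror ps) # us)"
      unfolding 2 using twist_chords by metis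
    moreover have "same_tree xs (Node (mirror ps) # us)"
      using xs same_tree.move[OF len] same_tree.rot[of us "[Node ps]"]
        same_tree.twist[of ps us] same_tree.trans by (metis append_Cons append_Nil)
    ultimately show ?thesis using off by simp
  qed
qed

text \<open>When the last branch is the side from \<open>N - 1\<close> back to 0, all arcs end at
  \<open>N - 1\<close> or earlier, and the reduction modulo \<open>N\<close> does nothing.\<close>

lemma chords_last_Leaf:
  assumes "valid ts" "N = int (leaves ts) + 1"
  shows "chords N 0 (ts @ [Leaf]) = (\<lambda>(i, j). {i, j}) ` arcs ts 0"
proof -
  have "chord N p = (case p of (i, j) \<Rightarrow> {i, j})" if "p \<in> arcs ts 0" for p
    using arcs_bounds[OF assms(1), of "fst p" "snd p" 0] that assms(2)
    by (simp add: chord_def case_prod_unfold)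
  then show ?thesis by (simp add: chords_def arcs_append)
qed

lemma inj_on_doubleton: "inj_on (\<lambda>(i, j). {i, j}) {(i, j). i < (j :: int)}"
  by (auto simp: inj_on_def doubleton_eq_iff)

lemma arcs_subset_less: "valid ts \<Longrightarrow> arcs ts a \<subseteq> {(i, j). i < j}"
  using arcs_bounds by fastforce

text \<open>Both lists are rooted at the side from \<open>N - 1\<close> to 0. There the chords
  determine the arcs, and the arcs determine the forest.\<close>

lemma chords_inject:
  assumes "cell xs" "cell ys" "N = int (leaves xs)" "N = int (leaves ys)" "chords N 0 xs = chords N 0 ys"
  shows "same_tree xs ys"
proof -
  obtain xs' where xs': "same_tree xs (xs' @ [Leaf])" "chords N 0 xs = chords N 0 (xs' @ [Leaf])"
    using ex_last_Leaf[OF assms(1)] assms(3) by blast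
  obtain ys' where ys': "same_tree ys (ys' @ [Leaf])" "chords N 0 ys = chords N 0 (ys' @ [Leaf])"
    using ex_last_Leaf[OF assms(2)] assms(4) by blast
  have v: "valid xs'" "valid ys'" "N = int (leaves xs') + 1" "N = int (leaves ys') + 1"
    using same_tree_invariants[OF xs'(1)] same_tree_invariants[OF ys'(1)] assms by (auto simp: cell_def)
  have "(\<lambda>(i, j). {i, j}) ` arcs xs' 0 = (\<lambda>(i, j). {i, j}) ` arcs ys' 0"
    using xs'(2) ys'(2) assms(5) chords_last_Leaf v by metis
  then have "arcs xs' 0 = arcs ys' 0"
    using inj_on_image_eq_iff[OF inj_on_doubleton] arcs_subset_less v by metis
  then have "xs' = ys'" using arcs_inject v by auto
  then show ?thesis using xs'(1) ys'(1) same_tree.sym same_tree.trans by blast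
qed

lemma same_class_iff_same_tree:
  assumes "cell xs" "cell ys" "N = int (leaves xs)" "N = int (leaves ys)"
  shows "same_class N (chords N 0 xs) (chords N 0 ys) \<longleftrightarrow> same_tree xs ys"
proof
  assume "same_class N (chords N 0 xs) (chords N 0 ys)"
  from same_class_imp_same_tree[OF this HOL.refl assms(1,3)] obtain zs where
    zs: "same_tree xs zs" "chords N 0 ys = chords N 0 zs" by blast
  then have "same_tree ys zs"
    using chords_inject[of ys zs N] assms same_tree_invariants by metis
  then show "same_tree xs ys" using zs same_tree.sym same_tree.trans by blast
qed (use assms same_tree_imp_same_class in blast)

lemma crossing_doubleton:
  assumes "i < j" "k < (l :: int)"
  shows "crossing {i, j} {k, l} \<longleftrightarrow> crossing_arcs (i, j) (k, l) \<or> crossing_arcs (k, l) (i, j)"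
  using assms unfolding crossing_def crossing_arcs_def by (auto simp: doubleton_eq_iff)

lemma dissection_chords:
  assumes "valid ts" "2 \<le> length ts" "N = int (leaves ts) + 1"
  shows "dissection N (chords N 0 (ts @ [Leaf]))" "card (chords N 0 (ts @ [Leaf])) = nodes ts"
proof -
  note eq = chords_last_Leaf[OF assms(1,3)]
  show "card (chords N 0 (ts @ [Leaf])) = nodes ts"
    unfolding eq using card_image inj_on_subset[OF inj_on_doubleton arcs_subset_less[OF assms(1)]]
      card_arcs[OF assms(1)] by metis
  have "{i, j} \<in> diagonals N" if "(i, j) \<in> arcs ts 0" for i j
    using arcs_bounds[OF assms(1) that] arcs_not_whole[OF assms(1,2), of 0] that assms(3)
    unfolding diagonals_def by auto
  moreover have "\<not> crossing {i, j} {k, l}" if "(i, j) \<in> arcs ts 0" "(k, l) \<in> arcs ts 0" for i j k l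
    using arcs_noncrossing[OF assms(1) that] arcs_noncrossing[OF assms(1) that(2,1)]
      arcs_subset_less[OF assms(1)] that by (subst crossing_doubleton) auto
  ultimately show "dissection N (chords N 0 (ts @ [Leaf]))"
    unfolding dissection_def eq by auto
qed

lemma ex_chords_dissection:
  assumes "dissection N D" "3 \<le> N"
  shows "\<exists>ts. valid ts \<and> 2 \<le> length ts \<and> N = int (leaves ts) + 1 \<and> D = chords N 0 (ts @ [Leaf])"
proof -
  define S where "S = {(i, j). i < j \<and> {i, j} \<in> D}"
  have dg: "0 \<le> i \<and> i + 2 \<le> j \<and> j < N \<and> (i, j) \<noteq> (0, N - 1)" if "(i, j) \<in> S" for i j
    using that assms(1) unfolding S_def dissection_def diagonals_def
    by (fastforce simp: doubleton_eq_iff)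
  have "\<not> crossing_arcs p q" if "p \<in> S" "q \<in> S" for p q
  proof -
    have "\<not> crossing {fst p, snd p} {fst q, snd q}"
      using that assms(1) unfolding S_def dissection_def by auto
    then show ?thesis using crossing_doubleton[of "fst p" "snd p" "fst q" "snd q"] that
      by (auto simp: S_def)
  qed
  then obtain ts where ts: "valid ts" "int (leaves ts) = N - 1 - 0" "arcs ts 0 = S"
    using arcs_exists[of 0 "N - 1" S] dg assms(2) by fastforce
  have "D = (\<lambda>(i, j). {i, j}) ` S"
  proof
    show "D \<subseteq> (\<lambda>(i, j). {i, j}) ` S"
    proof
      fix d assume d: "d \<in> D"
      then obtain i j where "d = {i, j}" "i + 2 \<le> j"
        using assms(1) unfolding dissection_def diagonals_def by blast
      then show "d \<in> (\<lambda>(i, j). {i, j}) ` S" using d by (auto simp: S_def intro!: image_eqI[of _ _ "(i, j)"])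
    qed
  qed (auto simp: S_def)
  \<comment> \<open>As \<open>N\<close> is at least 3, a single tree would have to be a node with
    the arc (0, N - 1), which is a side of the polygon.\<close>
  moreover have "2 \<le> length ts"
  proof (rule ccontr)
    assume "\<not> ?thesis"
    then have "length ts = 0 \<or> length ts = 1" by linarith
    then consider "ts = []" | "ts = [Leaf]" | us where "ts = [Node us]"
      by (auto simp: length_Suc_conv) (metis ptree.exhaust)
    then show False using ts assms(2) dg[of 0 "N - 1"] by cases auto
  qed
  ultimately show ?thesis using ts chords_last_Leaf[of ts N] by (intro exI[of _ ts]) auto
qed

section \<open>Normal forms and the center of a tree\<close>

text \<open>The order given by \<^const>\<open>to_nat\<close> is arbitrary; it only selects one of a list and its reverse.\<close>

definition canon :: "ptree list \<Rightarrow> ptree list" where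
  "canon us = (if to_nat us \<le> to_nat (rev us) then us else rev us)"

text \<open>Normal form under independent reversals at all inner nodes. The top list stays as it is,
  because it is a cyclic arrangement and is treated by \<open>dihedral_orbit\<close>.\<close>

fun nf :: "ptree list \<Rightarrow> ptree list" where
  "nf [] = []"
| "nf (Leaf # ts) = Leaf # nf ts"
| "nf (Node us # ts) = Node (canon (nf us)) # nf ts"

lemma canon_cases: "canon us = us \<or> canon us = rev us"
  by (simp add: canon_def)

lemma canon_rev [simp]: "canon (rev us) = canon us"
  by (auto simp: canon_def)

lemma canon_canon [simp]: "canon (canon us) = canon us"
  by (auto simp: canon_def)

lemma leaves_rev [simp]: "leaves (rev xs) = leaves xs"
  by (induction xs rule: leaves.induct) auto

lemma nodes_rev [simp]: "nodes (rev xs) = nodes xs"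
  by (induction xs rule: nodes.induct) auto

lemma valid_rev [simp]: "valid (rev xs) \<longleftrightarrow> valid xs"
  by (induction xs rule: valid.induct) auto

lemma canon_simps [simp]:
  "leaves (canon us) = leaves us" "nodes (canon us) = nodes us"
  "valid (canon us) \<longleftrightarrow> valid us" "length (canon us) = length us"
  by (simp_all add: canon_def)

lemma nf_append [simp]: "nf (xs @ ys) = nf xs @ nf ys"
  by (induction xs rule: nf.induct) auto

lemma nf_rev [simp]: "nf (rev xs) = rev (nf xs)"
  by (induction xs rule: nf.induct) auto

lemma nf_mirror [simp]: "nf (mirror xs) = rev (nf xs)"
  by (induction xs rule: nf.induct) auto

lemma length_nf [simp]: "length (nf xs) = length xs"
  by (induction xs rule: nf.induct) auto

lemma leaves_nf [simp]: "leaves (nf xs) = leaves xs"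
  by (induction xs rule: nf.induct) auto

lemma nodes_nf [simp]: "nodes (nf xs) = nodes xs"
  by (induction xs rule: nf.induct) auto

lemma valid_nf [simp]: "valid (nf xs) \<longleftrightarrow> valid xs"
  by (induction xs rule: nf.induct) auto

lemma nf_canon: "nf (canon us) = (if canon us = us then nf us else rev (nf us))"
  using canon_cases[of us] by auto

lemma nf_nf [simp]: "nf (nf xs) = nf xs"
  by (induction xs rule: nf.induct) (auto simp: nf_canon canon_def)

lemma cell_nf [simp]: "cell (nf xs) \<longleftrightarrow> cell xs"
  by (simp add: cell_def)

text \<open>\<open>mirror\<close> reverses at every depth; twisting each branch undoes this below
  the top level and leaves the plain reversal.\<close>

lemma same_tree_mirror_context: "same_tree (mirror us @ cs) (rev us @ cs)"
proof (induction us arbitrary: cs)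
  case (Cons u us)
  have "same_tree (mirror us @ mirror [u] @ cs) (mirror us @ [u] @ cs)"
  proof (cases u)
    case (Node vs)
    have "same_tree (mirror us @ (Node (mirror vs) # cs)) ((Node (mirror vs) # cs) @ mirror us)"
      by (rule same_tree.rot)
    moreover have "same_tree (Node (mirror vs) # cs @ mirror us) (Node vs # cs @ mirror us)"
      using same_tree.twist same_tree.sym by blast
    moreover have "same_tree ((Node vs # cs) @ mirror us) (mirror us @ (Node vs # cs))"
      by (rule same_tree.rot)
    ultimately show ?thesis unfolding Node mirror.simps append.simps by (blast intro: same_tree.trans)
  qed (simp add: same_tree.refl)
  moreover have "mirror (u # us) = mirror us @ mirror [u]"
    using mirror_append[of "[u]" us] by simp
  ultimately show ?case using Cons[of "[u] @ cs"] by (auto intro: same_tree.trans)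
qed (simp add: same_tree.refl)

lemma same_tree_rev: "same_tree xs (rev xs)"
  using same_tree_mirror_context[of xs "[]"] same_tree.flip[of xs] by (auto intro: same_tree.trans)

text \<open>Reversal at one inner node alone: after the twist the root is moved into that node,
  where its children are branches and can be twisted back, and then returned.\<close>

lemma same_tree_Node_rev:
  assumes "2 \<le> length us" "2 \<le> length ps"
  shows "same_tree (Node us # ps) (Node (rev us) # ps)"
proof -
  have "same_tree (Node us # ps) (Node (mirror us) # ps)" by (rule same_tree.twist)
  moreover have "same_tree (Node (mirror us) # ps) (mirror us @ [Node ps])"
    using assms by (intro same_tree.move) auto
  moreover have "same_tree (mirror us @ [Node ps]) (rev us @ [Node ps])"
    by (rule same_tree_mirror_context)
  moreover have "same_tree (rev us @ [Node ps]) (Node (rev us) # ps)"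
    using assms by (intro same_tree.sym[OF same_tree.move]) auto
  ultimately show ?thesis using same_tree.trans by blast
qed

text \<open>The children of a node are normalised with the root placed in that node; the rest of the
  cell is then the single context branch \<open>Node (ts @ cs)\<close>.\<close>

lemma same_tree_nf_context:
  "valid us \<Longrightarrow> 3 \<le> length (us @ cs) \<Longrightarrow> same_tree (us @ cs) (nf us @ cs)"
proof (induction us arbitrary: cs rule: nf.induct)
  case (2 ts)
  have "same_tree ((Leaf # ts) @ cs) (ts @ cs @ [Leaf])"
    using same_tree.rot[of "[Leaf]" "ts @ cs"] by simp
  moreover have "same_tree (ts @ cs @ [Leaf]) (nf ts @ cs @ [Leaf])"
    using 2 by simp
  moreover have "same_tree (nf ts @ cs @ [Leaf]) ((Leaf # nf ts) @ cs)"
    using same_tree.rot[of "nf ts @ cs" "[Leaf]"] by simp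
  ultimately show ?case unfolding nf.simps append_Cons by (blast intro: same_tree.trans)
next
  case (3 us ts)
  have len: "2 \<le> length us" "2 \<le> length (ts @ cs)" using 3 by auto
  have "same_tree ((Node us # ts) @ cs) (us @ [Node (ts @ cs)])"
    using same_tree.move[OF len] by simp
  moreover have "same_tree (us @ [Node (ts @ cs)]) (nf us @ [Node (ts @ cs)])"
    using 3 by simp
  moreover have "same_tree (nf us @ [Node (ts @ cs)]) (Node (nf us) # ts @ cs)"
    using len by (intro same_tree.sym[OF same_tree.move]) auto
  moreover have "same_tree (Node (nf us) # ts @ cs) (Node (canon (nf us)) # ts @ cs)"
    using canon_cases[of "nf us"] same_tree_Node_rev[of "nf us" "ts @ cs"] len same_tree.refl by auto
  moreover have "same_tree (Node (canon (nf us)) # ts @ cs) (ts @ cs @ [Node (canon (nf us))])"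
    using same_tree.rot[of "[Node (canon (nf us))]" "ts @ cs"] by simp
  moreover have "same_tree (ts @ cs @ [Node (canon (nf us))]) (nf ts @ cs @ [Node (canon (nf us))])"
    using 3 by simp
  moreover have "same_tree (nf ts @ cs @ [Node (canon (nf us))]) (Node (canon (nf us)) # nf ts @ cs)"
    using same_tree.rot[of "nf ts @ cs" "[Node (canon (nf us))]"] by simp
  ultimately show ?case unfolding nf.simps append_Cons by (blast intro: same_tree.trans)
qed (simp add: same_tree.refl)

lemma same_tree_nf: "cell xs \<Longrightarrow> same_tree xs (nf xs)"
  using same_tree_nf_context[of xs "[]"] by (simp add: cell_def)

section \<open>Dihedral orbits of lists\<close>

definition dihedral_orbit :: "'a list \<Rightarrow> 'a list set" where
  "dihedral_orbit xs = range (\<lambda>j. rotate j xs) \<union> range (\<lambda>j. rotate j (rev xs))"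

lemma rev_rotate: "rev (rotate j xs) = rotate (length xs - j mod length xs) (rev xs)"
  using rotate_rev[of j "rev xs"] by simp

lemma rotate_inverse: "rotate (length xs - j mod length xs) (rotate j xs) = xs"
proof (cases "xs = []")
  case False
  then have "(length xs - j mod length xs + j) mod length xs = 0"
    by (metis add.commute le_add_diff_inverse length_greater_0_conv mod_add_left_eq mod_less_divisor
        mod_self order_less_imp_le)
  then show ?thesis by (simp add: rotate_rotate)
qed simp

lemma dihedral_orbit_refl: "xs \<in> dihedral_orbit xs"
  unfolding dihedral_orbit_def by (rule UnI1, rule range_eqI[of _ _ 0]) simp

lemma dihedral_orbit_mono: "ys \<in> dihedral_orbit xs \<Longrightarrow> dihedral_orbit ys \<subseteq> dihedral_orbit xs"
  unfolding dihedral_orbit_def by (auto simp: rotate_rotate rev_rotate)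

lemma dihedral_orbit_sym: "ys \<in> dihedral_orbit xs \<Longrightarrow> xs \<in> dihedral_orbit ys"
proof -
  have "xs \<in> dihedral_orbit (rotate j xs)" for j and xs :: "'a list"
    unfolding dihedral_orbit_def using rotate_inverse[of xs j] by (metis UnI1 rangeI)
  moreover have "xs \<in> dihedral_orbit (rev xs)" for xs :: "'a list"
    unfolding dihedral_orbit_def by (rule UnI2, rule range_eqI[of _ _ 0]) simp
  ultimately show "ys \<in> dihedral_orbit xs \<Longrightarrow> xs \<in> dihedral_orbit ys"
    unfolding dihedral_orbit_def[of xs] using dihedral_orbit_mono by blast
qed

lemma dihedral_orbit_eq: "ys \<in> dihedral_orbit xs \<Longrightarrow> dihedral_orbit ys = dihedral_orbit xs"
  using dihedral_orbit_mono dihedral_orbit_sym by blast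

lemma dihedral_orbit_rev [simp]: "dihedral_orbit (rev xs) = dihedral_orbit xs"
  by (rule dihedral_orbit_eq) (metis dihedral_orbit_def UnI2 rangeI id_apply rotate0)

lemma dihedral_orbit_append: "dihedral_orbit (xs @ ys) = dihedral_orbit (ys @ xs)"
  by (rule dihedral_orbit_eq) (metis dihedral_orbit_def UnI1 rangeI rotate_append)

lemma rotate_split: "\<exists>us vs. xs = us @ vs \<and> rotate j xs = vs @ us"
  by (metis append_take_drop_id rotate_drop_take)

lemma dihedral_orbit_cases:
  assumes "ys \<in> dihedral_orbit xs"
  obtains us vs where "xs = us @ vs" "ys = vs @ us" | us vs where "rev xs = us @ vs" "ys = vs @ us"
proof -
  from assms obtain j where "ys = rotate j xs \<or> ys = rotate j (rev xs)"
    by (auto simp: dihedral_orbit_def)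
  then show thesis using that rotate_split[of xs j] rotate_split[of "rev xs" j] by auto
qed

lemma dihedral_orbit_set: "ys \<in> dihedral_orbit xs \<Longrightarrow> set ys = set xs"
  by (auto simp: dihedral_orbit_def)

lemma dihedral_orbit_same_tree: "ys \<in> dihedral_orbit xs \<Longrightarrow> same_tree xs ys"
  by (erule dihedral_orbit_cases) (metis same_tree.rot, metis same_tree.rot same_tree_rev same_tree.trans)

section \<open>Moving the root towards a dominating branch\<close>

definition key :: "ptree \<Rightarrow> nat \<times> nat" where
  "key t = (nodes [t], to_nat t)"

text \<open>Injectivity of \<open>to_nat\<close> leaves ties to equal trees only, while comparing
  \<open>nodes\<close> first makes every tree outrank its own children.\<close>

lemma key_eq_iff [simp]: "key s = key t \<longleftrightarrow> s = t"
  by (auto simp: key_def)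

lemma key_less: "nodes [s] < nodes [t] \<Longrightarrow> key s < key t"
  by (simp add: key_def)

lemma nodes_mem_le: "t \<in> set ts \<Longrightarrow> nodes [t] \<le> nodes ts"
proof -
  assume "t \<in> set ts"
  then obtain us vs where "ts = us @ [t] @ vs" by (metis append_Cons append_Nil split_list)
  then show ?thesis by (simp only: nodes_append)
qed

text \<open>
  In the cell with branches \<open>Node us # ps\<close>, the tree seen from behind the first branch
  is \<open>Node ps\<close>.
\<close>

definition heavy :: "ptree list \<Rightarrow> ptree list \<Rightarrow> bool" where
  "heavy us ps \<longleftrightarrow> key (Node (canon ps)) < key (Node us)"

text \<open>A branch among \<open>ps\<close> has fewer nodes than \<open>Node ps\<close>, which in
  turn ranks below \<open>Node us\<close>.\<close>

lemma heavy_less: "heavy us ps \<Longrightarrow> t \<in> set ps \<Longrightarrow> key t < key (Node us)"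
  using nodes_mem_le[of t ps] by (auto simp: heavy_def key_def)

text \<open>By \<open>heavy_less\<close> a heavy branch is the strict maximum of its cell, so any
  two coincide and it occurs only once. Putting it first then fixes the cyclic arrangement up to
  reversing the rest.\<close>

lemma heavy_unique:
  assumes "Node us' # ps' \<in> dihedral_orbit (Node us # ps)" "heavy us ps" "heavy us' ps'"
  shows "us' = us \<and> (ps' = ps \<or> ps' = rev ps)"
proof -
  have "set (Node us' # ps') = set (Node us # ps)"
    using assms(1) by (rule dihedral_orbit_set)
  then have "Node us' \<in> set (Node us # ps)" "Node us \<in> set (Node us' # ps')" by auto
  then have us: "us' = us" using heavy_less[OF assms(2)] heavy_less[OF assms(3)] by force
  let ?q = "Node us"
  have nin: "?q \<notin> set ps" using heavy_less[OF assms(2)] by blast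
  from assms(1) show ?thesis
  proof (cases rule: dihedral_orbit_cases)
    case (1 as bs)
    then show ?thesis using nin us by (auto simp: Cons_eq_append_conv)
  next
    case (2 as bs)
    have "ps' = rev ps"
    proof (cases bs rule: rev_cases)
      case Nil
      then show ?thesis using 2 nin us by (cases "rev ps") auto
    next
      case (snoc bs' b)
      then show ?thesis using 2 nin us by (cases bs') (auto simp: append_eq_append_conv2, metis Un_iff list.set_intros(1) set_append set_rev)
    qed
    then show ?thesis using us by simp
  qed
qed

text \<open>The choice is immaterial: by \<open>heavy_unique\<close> all candidates give the same
  orbit, as \<open>canon\<close> does not see whether \<open>ps\<close> was reversed. It also keeps
  the new branch in normal form.\<close>

definition shift_root :: "ptree list set \<Rightarrow> ptree list set" where
  "shift_root X = (if \<exists>us ps. Node us # ps \<in> X \<and> heavy us ps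
     then SOME Y. \<exists>us ps. Node us # ps \<in> X \<and> heavy us ps \<and> Y = dihedral_orbit (us @ [Node (canon ps)])
     else X)"

lemma shift_root_heavy:
  assumes "heavy us ps"
  shows "shift_root (dihedral_orbit (Node us # ps)) = dihedral_orbit (us @ [Node (canon ps)])"
proof -
  let ?X = "dihedral_orbit (Node us # ps)"
  let ?P = "\<lambda>Y. \<exists>us ps. Node us # ps \<in> ?X \<and> heavy us ps \<and> Y = dihedral_orbit (us @ [Node (canon ps)])"
  have ex: "?P (dihedral_orbit (us @ [Node (canon ps)]))"
    using assms dihedral_orbit_refl by blast
  then have "shift_root ?X = (SOME Y. ?P Y)"
    unfolding shift_root_def by (subst if_P) (blast, rule HOL.refl)
  moreover have "Y = dihedral_orbit (us @ [Node (canon ps)])" if "?P Y" for Y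
    using that heavy_unique[OF _ assms] by fastforce
  ultimately show ?thesis using someI[of ?P, OF ex] by simp
qed

lemma shift_root_cases:
  obtains us ps where "Node us # ps \<in> X" "heavy us ps" | "shift_root X = X"
  unfolding shift_root_def by meson

definition max_key :: "ptree list set \<Rightarrow> nat \<times> nat" where
  "max_key X = Max (key ` \<Union> (set ` X))"

lemma max_key_dihedral_orbit: "max_key (dihedral_orbit xs) = Max (key ` set xs)"
proof -
  have "\<Union> (set ` dihedral_orbit xs) = set xs"
    using dihedral_orbit_set dihedral_orbit_refl by blast
  then show ?thesis by (simp add: max_key_def)
qed

text \<open>The heavy branch is replaced by its own children, which have fewer nodes, and by the
  tree behind it, which is lighter by assumption. Hence the walk of the root stops.\<close>

lemma max_key_shift_root:
  assumes "X = dihedral_orbit (Node us # ps)" "heavy us ps"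
  shows "max_key (shift_root X) < max_key X"
proof -
  have "key t < key (Node us)" if "t \<in> set us" for t
    using nodes_mem_le[OF that] by (intro key_less) simp
  then have "max_key (shift_root X) < key (Node us)"
    using assms(2) unfolding assms(1) shift_root_heavy[OF assms(2)] max_key_dihedral_orbit
    by (subst Max_less_iff) (auto simp: heavy_def)
  also have "\<dots> \<le> max_key X" unfolding assms(1) max_key_dihedral_orbit by (intro Max_ge) auto
  finally show ?thesis .
qed

section \<open>Limits of terminating iterations\<close>

definition limit_point :: "('a \<Rightarrow> 'a) \<Rightarrow> 'a \<Rightarrow> 'a" where
  "limit_point f x = (THE r. f r = r \<and> (\<exists>n. r = (f ^^ n) x))"

text \<open>Iterates are constant after a fixed point, so both fixed points equal the iterate number
  n + m.\<close>

lemma funpow_fixpoint_unique: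
  assumes "f ((f ^^ n) x) = (f ^^ n) x" "f ((f ^^ m) x) = (f ^^ m) x"
  shows "(f ^^ n) x = (f ^^ m) x"
proof -
  have *: "(f ^^ (k + n)) x = (f ^^ n) x" if "f ((f ^^ n) x) = (f ^^ n) x" for k n
    by (induction k) (use that in auto)
  show ?thesis using *[OF assms(1), of m] *[OF assms(2), of n] by (simp add: add.commute)
qed

lemma limit_point_eqI:
  assumes "f ((f ^^ n) x) = (f ^^ n) x"
  shows "limit_point f x = (f ^^ n) x"
  unfolding limit_point_def
proof (rule the_equality)
  fix r assume "f r = r \<and> (\<exists>m. r = (f ^^ m) x)"
  then obtain m where "r = (f ^^ m) x" "f ((f ^^ m) x) = (f ^^ m) x" by auto
  then show "r = (f ^^ n) x" using funpow_fixpoint_unique[of f m x n] assms by simp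
qed (use assms in auto)

lemma limit_point_exists:
  fixes \<mu> :: "'a \<Rightarrow> 'b :: wellorder"
  assumes "\<And>x. x \<in> V \<Longrightarrow> f x \<in> V \<and> (f x = x \<or> \<mu> (f x) < \<mu> x)" "x \<in> V"
  shows "\<exists>n. limit_point f x = (f ^^ n) x \<and> (f ^^ n) x \<in> V \<and> f ((f ^^ n) x) = (f ^^ n) x"
proof -
  have "\<exists>n. (f ^^ n) x \<in> V \<and> f ((f ^^ n) x) = (f ^^ n) x"
    using assms(2)
  proof (induction "\<mu> x" arbitrary: x rule: less_induct)
    case less
    show ?case
    proof (cases "f x = x")
      case True
      then show ?thesis using less.prems by (intro exI[of _ 0]) simp
    next
      case False
      then obtain n where "(f ^^ n) (f x) \<in> V \<and> f ((f ^^ n) (f x)) = (f ^^ n) (f x)"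
        using less assms(1) by blast
      then show ?thesis by (intro exI[of _ "Suc n"]) (simp add: funpow_swap1)
    qed
  qed
  then obtain n where n: "(f ^^ n) x \<in> V" "f ((f ^^ n) x) = (f ^^ n) x" by blast
  from limit_point_eqI[OF n(2)] n show ?thesis by blast
qed

lemma limit_point_step:
  fixes \<mu> :: "'a \<Rightarrow> 'b :: wellorder"
  assumes "\<And>x. x \<in> V \<Longrightarrow> f x \<in> V \<and> (f x = x \<or> \<mu> (f x) < \<mu> x)" "x \<in> V"
  shows "limit_point f (f x) = limit_point f x"
proof -
  have "f x \<in> V" using assms by blast
  then obtain n where n: "limit_point f (f x) = (f ^^ n) (f x)" "f ((f ^^ n) (f x)) = (f ^^ n) (f x)"
    using limit_point_exists[of V f \<mu>] assms(1) by blast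
  then show ?thesis using limit_point_eqI[of f "Suc n" x] by (simp add: funpow_swap1)
qed


section \<open>Movable cell rootings and pairs of planted trees\<close>

definition cells :: "nat \<Rightarrow> nat \<Rightarrow> ptree list set" where
  "cells N m = {xs. cell xs \<and> leaves xs = N \<and> nodes xs = m}"

definition cell_classes :: "nat \<Rightarrow> nat \<Rightarrow> ptree list set set" where
  "cell_classes N m = dihedral_orbit ` {xs \<in> cells N m. nf xs = xs}"

text \<open>The trees at the two ends of a diagonal; the strict ranking lists each unordered pair of
  distinct trees once. Both end cells are nodes here, whereas in \<open>cells N m\<close> one of
  them is the uncounted root, which explains \<open>Suc m\<close>.\<close>

definition edge_pairs :: "nat \<Rightarrow> nat \<Rightarrow> (ptree list \<times> ptree list) set" where
  "edge_pairs N m = {(ps, us). valid [Node ps, Node us] \<and> nf [Node ps, Node us] = [Node ps, Node us] \<and>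
     key (Node ps) < key (Node us) \<and> leaves [Node ps, Node us] = N \<and> nodes [Node ps, Node us] = Suc m}"

text \<open>A first leaf uses up one of the allowed leaves and a first inner node one of the allowed
  nodes, so \<open>N + m\<close> decreases.\<close>

lemma finite_valid_bounded: "finite {xs. valid xs \<and> leaves xs \<le> N \<and> nodes xs \<le> m}" (is "finite (?F N m)")
proof (induction "N + m" arbitrary: N m rule: less_induct)
  case less
  have "?F N m \<subseteq> {[]} \<union> (if N = 0 then {} else (#) Leaf ` ?F (N - 1) m) \<union>
     (if m = 0 then {} else (\<lambda>(us, ts). Node us # ts) ` (?F N (m - 1) \<times> ?F N (m - 1)))"
  proof
    fix xs assume "xs \<in> ?F N m"
    then show "xs \<in> {[]} \<union> (if N = 0 then {} else (#) Leaf ` ?F (N - 1) m) \<union>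
     (if m = 0 then {} else (\<lambda>(us, ts). Node us # ts) ` (?F N (m - 1) \<times> ?F N (m - 1)))"
      by (cases xs rule: nf.cases) auto
  qed
  moreover have "N \<noteq> 0 \<Longrightarrow> finite (?F (N - 1) m)" "m \<noteq> 0 \<Longrightarrow> finite (?F N (m - 1))"
    using less by simp_all
  ultimately show ?case by (elim finite_subset) auto
qed

lemma finite_cells: "finite (cells N m)"
  by (rule finite_subset[OF _ finite_valid_bounded[of N m]]) (auto simp: cells_def cell_def)

lemma finite_cell_classes: "finite (cell_classes N m)"
  using finite_cells by (simp add: cell_classes_def)

lemma nf_Node_fixed: "nf [Node us] = [Node us] \<longleftrightarrow> nf us = us \<and> canon us = us"
proof
  assume "nf [Node us] = [Node us]"
  then have e: "canon (nf us) = us" by simp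
  have "canon us = us" using canon_canon[of "nf us"] e by simp
  moreover have "nf us = us" using nf_canon[of "nf us"] e canon_cases[of "nf us"] by (auto split: if_splits)
  ultimately show "nf us = us \<and> canon us = us" by simp
qed simp

lemma dihedral_orbit_cell:
  assumes "ys \<in> dihedral_orbit xs" "xs \<in> cells N m" "nf xs = xs"
  shows "ys \<in> cells N m" "nf ys = ys"
proof -
  show "ys \<in> cells N m"
    using same_tree_invariants[OF dihedral_orbit_same_tree[OF assms(1)]] assms(2) by (auto simp: cells_def)
  from assms(1) show "nf ys = ys"
  proof (cases rule: dihedral_orbit_cases)
    case (1 us vs)
    then show ?thesis using assms(3) by (auto simp: append_eq_append_conv)
  next
    case (2 us vs)
    then show ?thesis using nf_rev[of xs] assms(3) by (auto simp: append_eq_append_conv)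
  qed
qed

lemma shift_root_cell_classes:
  assumes "X \<in> cell_classes N m"
  shows "shift_root X \<in> cell_classes N m \<and> (shift_root X = X \<or> max_key (shift_root X) < max_key X)"
proof (cases rule: shift_root_cases[of X])
  case (1 us ps)
  from assms obtain xs where xs: "xs \<in> cells N m" "nf xs = xs" "X = dihedral_orbit xs"
    by (auto simp: cell_classes_def)
  note q = dihedral_orbit_cell[OF 1(1)[unfolded xs(3)] xs(1,2)]
  have X: "X = dihedral_orbit (Node us # ps)" using dihedral_orbit_eq 1(1) xs(3) by blast
  have "us @ [Node (canon ps)] \<in> cells N m"
    using q(1) by (auto simp: cells_def cell_def)
  moreover have "nf us = us" "nf ps = ps"
    using q(2) nf_append[of "[Node us]" ps] nf_Node_fixed[of us] by auto
  then have "nf (us @ [Node (canon ps)]) = us @ [Node (canon ps)]"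
    using canon_cases[of ps] by auto
  ultimately have "shift_root X \<in> cell_classes N m"
    unfolding X shift_root_heavy[OF 1(2)] cell_classes_def by blast
  then show ?thesis using max_key_shift_root[OF X 1(2)] by blast
qed (use assms in simp)

text \<open>A movable rooting has exactly one diagonal to be crossed, between its heavy branch and
  the rest of the cell. Heaviness is the strict ranking of the pair, and \<open>heavy_unique\<close>
  recovers the pair from the orbit.\<close>

lemma bij_betw_edge_pairs:
  "bij_betw (\<lambda>(ps, us). dihedral_orbit (Node us # ps)) (edge_pairs N m)
     {X \<in> cell_classes N m. shift_root X \<noteq> X}"
proof -
  have heavy: "heavy us ps" "canon ps = ps" "nf ps = ps" "nf us = us" "canon us = us"
    "Node us # ps \<in> cells N m" if "(ps, us) \<in> edge_pairs N m" for ps us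
  proof -
    from that have "nf [Node ps] = [Node ps]" "nf [Node us] = [Node us]"
      by (auto simp: edge_pairs_def)
    then show *: "canon ps = ps" "nf ps = ps" "nf us = us" "canon us = us"
      using nf_Node_fixed by blast+
    show "heavy us ps" "Node us # ps \<in> cells N m"
      using that * by (auto simp: edge_pairs_def heavy_def cells_def cell_def)
  qed
  show ?thesis
    unfolding bij_betw_def
  proof
    show "inj_on (\<lambda>(ps, us). dihedral_orbit (Node us # ps)) (edge_pairs N m)"
    proof (rule inj_onI, clarify)
      fix ps us ps' us'
      assume 1: "(ps, us) \<in> edge_pairs N m" "(ps', us') \<in> edge_pairs N m"
        and "dihedral_orbit (Node us # ps) = dihedral_orbit (Node us' # ps')"
      then have "Node us' # ps' \<in> dihedral_orbit (Node us # ps)"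
        using dihedral_orbit_refl by blast
      from heavy_unique[OF this] heavy[OF 1(1)] heavy[OF 1(2)]
      have "us' = us" "ps' = ps \<or> ps' = rev ps" by auto
      moreover from this have "ps' = ps" using heavy(2)[OF 1(1)] heavy(2)[OF 1(2)] canon_rev by metis
      ultimately show "ps = ps' \<and> us = us'" by simp
    qed
    show "(\<lambda>(ps, us). dihedral_orbit (Node us # ps)) ` edge_pairs N m =
      {X \<in> cell_classes N m. shift_root X \<noteq> X}"
    proof
      show "(\<lambda>(ps, us). dihedral_orbit (Node us # ps)) ` edge_pairs N m
        \<subseteq> {X \<in> cell_classes N m. shift_root X \<noteq> X}"
      proof clarify
        fix ps us assume "(ps, us) \<in> edge_pairs N m"
        note h = heavy[OF this]
        then have "dihedral_orbit (Node us # ps) \<in> cell_classes N m"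
          by (auto simp: cell_classes_def)
        moreover have "shift_root (dihedral_orbit (Node us # ps)) \<noteq> dihedral_orbit (Node us # ps)"
          using max_key_shift_root[OF HOL.refl h(1)] by auto
        ultimately show "dihedral_orbit (Node us # ps) \<in> cell_classes N m \<and>
          shift_root (dihedral_orbit (Node us # ps)) \<noteq> dihedral_orbit (Node us # ps)" by blast
      qed
      show "{X \<in> cell_classes N m. shift_root X \<noteq> X} \<subseteq>
        (\<lambda>(ps, us). dihedral_orbit (Node us # ps)) ` edge_pairs N m"
      proof clarify
        fix X assume X: "X \<in> cell_classes N m" "shift_root X \<noteq> X"
        then obtain us ps where q: "Node us # ps \<in> X" "heavy us ps"
          using shift_root_cases by metis
        from X(1) obtain xs where xs: "xs \<in> cells N m" "nf xs = xs" "X = dihedral_orbit xs"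
          by (auto simp: cell_classes_def)
        note c = dihedral_orbit_cell[OF q(1)[unfolded xs(3)] xs(1,2)]
        have X': "X = dihedral_orbit (Node us # ps)" using dihedral_orbit_eq q(1) xs(3) by blast
        have us: "nf us = us" "canon us = us" "nf ps = ps"
          using c(2) nf_append[of "[Node us]" ps] nf_Node_fixed[of us] by auto
        \<comment> \<open>The orbit does not distinguish \<open>ps\<close> from its reversal, so the
          canonical one may be taken.\<close>
        have "X = dihedral_orbit (Node us # canon ps)"
        proof (cases "canon ps = ps")
          case False
          then have "canon ps = rev ps" using canon_cases[of ps] by blast
          then show ?thesis
            using X' dihedral_orbit_append[of "[Node us]" "rev ps"] dihedral_orbit_rev[of "Node us # ps"] by simp
        qed (use X' in simp)
        moreover have "(canon ps, us) \<in> edge_pairs N m"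
          using us c(1) q(2) canon_cases[of ps] by (auto simp: edge_pairs_def heavy_def cells_def cell_def)
        ultimately show "X \<in> (\<lambda>(ps, us). dihedral_orbit (Node us # ps)) ` edge_pairs N m"
          by (intro image_eqI[of _ _ "(canon ps, us)"]) auto
      qed
    qed
  qed
qed

lemma card_shift_root_fixed:
  "card {X \<in> cell_classes N m. shift_root X = X} + card (edge_pairs N m) = card (cell_classes N m)"
proof -
  have "cell_classes N m = {X \<in> cell_classes N m. shift_root X = X} \<union> {X \<in> cell_classes N m. shift_root X \<noteq> X}"
    by blast
  then have "card (cell_classes N m) = 
    card {X \<in> cell_classes N m. shift_root X = X} + card {X \<in> cell_classes N m. shift_root X \<noteq> X}"
    using card_Un_disjoint[of "{X \<in> cell_classes N m. shift_root X = X}" "{X \<in> cell_classes N m. shift_root X \<noteq> X}"]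
      finite_cell_classes[of N m] by (smt (verit) disjoint_iff finite_subset mem_Collect_eq subset_eq)
  then show ?thesis using bij_betw_same_card[OF bij_betw_edge_pairs] by simp
qed

section \<open>The center as a complete invariant\<close>

definition center :: "ptree list \<Rightarrow> ptree list set" where
  "center xs = limit_point shift_root (dihedral_orbit (nf xs))"

lemma dihedral_orbit_nf_cell_classes: "xs \<in> cells N m \<Longrightarrow> dihedral_orbit (nf xs) \<in> cell_classes N m"
  by (auto simp: cells_def cell_classes_def)

lemma limit_point_shift_root:
  "X \<in> cell_classes N m \<Longrightarrow> limit_point shift_root (shift_root X) = limit_point shift_root X"
  by (rule limit_point_step[of "cell_classes N m" _ max_key]) (use shift_root_cell_classes in auto)

text \<open>The two lists are rooted at the two ends of one diagonal. If its sides differ, one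
  \<open>shift_root\<close> leads from one end to the other, so the walks merge; if they agree, both
  orbits are the same.\<close>

lemma center_move:
  assumes "2 \<le> length us" "2 \<le> length ps" "cell (Node us # ps)"
  shows "center (Node us # ps) = center (us @ [Node ps])"
proof -
  let ?q = "Node (canon (nf us))" and ?p = "Node (canon (nf ps))"
  let ?X = "dihedral_orbit (?q # nf ps)" and ?Y = "dihedral_orbit (nf us @ [?p])"
  have flip: "dihedral_orbit (s # canon ts) = dihedral_orbit (s # ts)" for s :: ptree and ts
    using canon_cases[of ts] dihedral_orbit_append[of "[s]" "rev ts"] dihedral_orbit_rev[of "s # ts"] by auto
  have Y: "?Y = dihedral_orbit (?p # nf us)" using dihedral_orbit_append[of "nf us" "[?p]"] by simp
  have shift: "shift_root (dihedral_orbit (Node (canon us) # ps)) = dihedral_orbit (Node (canon ps) # us)"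
    if "key (Node (canon ps)) < key (Node (canon us))" for us ps
    using shift_root_heavy[of "canon us" ps] that flip
      dihedral_orbit_append[of "canon us" "[Node (canon ps)]"] by (simp add: heavy_def)
  have mem: "?X \<in> cell_classes (leaves (Node us # ps)) (nodes (Node us # ps))"
    "?Y \<in> cell_classes (leaves (Node us # ps)) (nodes (Node us # ps))"
    using dihedral_orbit_nf_cell_classes[of "Node us # ps"] dihedral_orbit_nf_cell_classes[of "us @ [Node ps]"] assms
    by (simp_all add: cells_def cell_def)
  consider "key ?p < key ?q" | "key ?q < key ?p" | "?p = ?q"
    by (metis key_eq_iff linorder_less_linear)
  then have "limit_point shift_root ?X = limit_point shift_root ?Y"
  proof cases
    case 1
    then show ?thesis using limit_point_shift_root[OF mem(1)] shift Y by simp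
  next
    case 2
    then show ?thesis using limit_point_shift_root[OF mem(2)] shift Y by simp
  next
    case 3
    then have "?X = ?Y" using Y flip[of ?q "nf ps"] flip[of ?p "nf us"] by simp
    then show ?thesis by simp
  qed
  then show ?thesis by (simp add: center_def)
qed

lemma same_tree_center: "same_tree xs ys \<Longrightarrow> cell xs \<Longrightarrow> center xs = center ys"
proof (induction rule: same_tree.induct)
  case (sym xs ys)
  then show ?case using same_tree_invariants by metis
next
  case (trans xs ys zs)
  then show ?case using same_tree_invariants by metis
next
  case (rot xs ys)
  then show ?case using dihedral_orbit_append[of "nf xs" "nf ys"] by (simp add: center_def)
next
  case (move us ps)
  then show ?case by (rule center_move)
qed (simp_all add: center_def)

lemma cell_classes_member:
  assumes "X \<in> cell_classes N m" "xs \<in> X"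
  shows "xs \<in> cells N m" "nf xs = xs" "X = dihedral_orbit xs"
  using assms dihedral_orbit_cell dihedral_orbit_eq unfolding cell_classes_def by blast+

text \<open>A step is a \<open>move\<close> up to the replacement of \<open>ps\<close> by
  \<open>canon ps\<close>, which is a reversal at one node.\<close>

lemma shift_root_same_tree:
  assumes "X \<in> cell_classes N m" "xs \<in> X" "ys \<in> shift_root X"
  shows "same_tree xs ys"
proof (cases rule: shift_root_cases[of X])
  case (1 us ps)
  note c = cell_classes_member[OF assms(1) 1(1)]
  have len: "2 \<le> length us" "2 \<le> length ps" using c(1) by (auto simp: cells_def cell_def)
  have "same_tree xs (Node us # ps)"
    using cell_classes_member(3)[OF assms(1,2)] 1(1) dihedral_orbit_same_tree by blast
  moreover have "same_tree (Node us # ps) (us @ [Node ps])" using len by (rule same_tree.move)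
  moreover have "same_tree (us @ [Node ps]) (Node ps # us)" using same_tree.rot[of us "[Node ps]"] by simp
  moreover have "same_tree (Node ps # us) (Node (canon ps) # us)"
    using canon_cases[of ps] same_tree_Node_rev[OF len(2,1)] same_tree.refl by metis
  moreover have "same_tree (Node (canon ps) # us) (us @ [Node (canon ps)])"
    using same_tree.rot[of "[Node (canon ps)]" us] by simp
  moreover have "same_tree (us @ [Node (canon ps)]) ys"
    using assms(3) shift_root_heavy[OF 1(2)] c(3) dihedral_orbit_same_tree by simp
  ultimately show ?thesis by (blast intro: same_tree.trans)
next
  case 2
  then show ?thesis
    using assms cell_classes_member(3)[OF assms(1,2)] dihedral_orbit_same_tree by simp
qed

lemma center_fixed:
  assumes "xs \<in> cells N m"
  shows "center xs \<in> {X \<in> cell_classes N m. shift_root X = X}" "\<forall>ys\<in>center xs. same_tree xs ys"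
proof -
  let ?X = "dihedral_orbit (nf xs)"
  obtain n where n: "center xs = (shift_root ^^ n) ?X" "(shift_root ^^ n) ?X \<in> cell_classes N m"
    "shift_root ((shift_root ^^ n) ?X) = (shift_root ^^ n) ?X"
    using limit_point_exists[of "cell_classes N m" shift_root max_key ?X]
      shift_root_cell_classes dihedral_orbit_nf_cell_classes[OF assms] unfolding center_def by blast
  then show "center xs \<in> {X \<in> cell_classes N m. shift_root X = X}" by simp
  have "(shift_root ^^ k) ?X \<in> cell_classes N m \<and> (\<forall>ys\<in>(shift_root ^^ k) ?X. same_tree xs ys)" for k
  proof (induction k)
    case 0
    have "same_tree xs ys" if "ys \<in> dihedral_orbit (nf xs)" for ys
      using same_tree_nf[of xs] dihedral_orbit_same_tree[OF that] assms same_tree.trans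
      by (auto simp: cells_def)
    then show ?case using dihedral_orbit_nf_cell_classes[OF assms] by simp
  next
    case (Suc k)
    let ?Y = "(shift_root ^^ k) ?X"
    obtain ys where ys: "ys \<in> ?Y"
      using Suc dihedral_orbit_refl unfolding cell_classes_def by blast
    then show ?case
      using Suc shift_root_cell_classes[of ?Y] shift_root_same_tree[of ?Y N m ys] same_tree.trans
      by simp blast
  qed
  then show "\<forall>ys\<in>center xs. same_tree xs ys" using n(1) by simp
qed

text \<open>Every list in a center is equivalent to the start of the walk, so a shared center links
  the two starts.\<close>

lemma same_tree_iff_center:
  assumes "xs \<in> cells N m" "ys \<in> cells N m"
  shows "same_tree xs ys \<longleftrightarrow> center xs = center ys"
proof
  assume eq: "center xs = center ys"
  obtain zs where "zs \<in> center xs"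
    using center_fixed(1)[OF assms(1)] dihedral_orbit_refl unfolding cell_classes_def by blast
  then have "same_tree xs zs" "same_tree ys zs" using center_fixed(2) assms eq by blast+
  then show "same_tree xs ys" using same_tree.sym same_tree.trans by blast
qed (use assms same_tree_center in \<open>auto simp: cells_def\<close>)

lemma center_image: "center ` cells N m = {X \<in> cell_classes N m. shift_root X = X}"
proof
  show "{X \<in> cell_classes N m. shift_root X = X} \<subseteq> center ` cells N m"
  proof clarify
    fix X assume X: "X \<in> cell_classes N m" "shift_root X = X"
    then obtain xs where xs: "xs \<in> cells N m" "nf xs = xs" "X = dihedral_orbit xs"
      by (auto simp: cell_classes_def)
    then have "center xs = X"
      using limit_point_eqI[of shift_root 0 X] X(2) by (simp add: center_def)
    then show "X \<in> center ` cells N m" using xs(1) by blast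
  qed
qed (use center_fixed(1) in blast)

lemma card_face_classes:
  assumes "2 \<le> n"
  shows "card (face_classes n k) + card (edge_pairs (n + 1) k) = card (cell_classes (n + 1) k)"
proof -
  let ?N = "int n + 1" and ?F = "associahedron_faces n k"
  let ?R = "{(D, D'). D \<in> ?F \<and> D' \<in> ?F \<and> same_class ?N D D'}"
  have face: "chords ?N 0 xs \<in> ?F" if "xs \<in> cells (n + 1) k" for xs
  proof -
    from that have xs: "cell xs" "leaves xs = n + 1" "nodes xs = k" by (auto simp: cells_def)
    from ex_last_Leaf[OF xs(1)] obtain ts where
      ts: "same_tree xs (ts @ [Leaf])" "chords ?N 0 xs = chords ?N 0 (ts @ [Leaf])"
      using xs(2) by (auto simp: add.commute)
    then have "valid ts" "2 \<le> length ts" "?N = int (leaves ts) + 1" "nodes ts = k"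
      using same_tree_invariants[OF ts(1)] xs by (auto simp: cell_def)
    from dissection_chords[OF this(1-3)] this(4) show ?thesis
      unfolding ts(2) associahedron_faces_def by simp
  qed
  have rep: "\<exists>xs\<in>cells (n + 1) k. D = chords ?N 0 xs" if D: "D \<in> ?F" for D
  proof -
    have "dissection ?N D" using D by (simp add: associahedron_faces_def)
    from ex_chords_dissection[OF this] assms obtain ts where
      ts: "valid ts" "2 \<le> length ts" "?N = int (leaves ts) + 1" "D = chords ?N 0 (ts @ [Leaf])"
      by auto
    then have "ts @ [Leaf] \<in> cells (n + 1) k"
      using dissection_chords(2)[OF ts(1-3)] D by (auto simp: cells_def cell_def associahedron_faces_def)
    then show ?thesis using ts(4) by blast
  qed
  \<comment> \<open>This makes the center a function of the dissection. The representing list is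
    arbitrary by \<open>iff\<close>, and the face classes become the nonempty fibres of
    \<open>g\<close>.\<close>
  define g where "g D = center (SOME xs. xs \<in> cells (n + 1) k \<and> D = chords ?N 0 xs)" for D
  have iff: "same_class ?N (chords ?N 0 xs) (chords ?N 0 ys) \<longleftrightarrow> center xs = center ys"
    if "xs \<in> cells (n + 1) k" "ys \<in> cells (n + 1) k" for xs ys
    using that same_class_iff_same_tree[of xs ys ?N] same_tree_iff_center[OF that] by (auto simp: cells_def)
  have g: "g (chords ?N 0 xs) = center xs" if xs: "xs \<in> cells (n + 1) k" for xs
  proof -
    let ?P = "\<lambda>ys. ys \<in> cells (n + 1) k \<and> chords ?N 0 xs = chords ?N 0 ys"
    have "?P (SOME ys. ?P ys)" by (rule someI[of ?P xs]) (use xs in simp)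
    then show ?thesis using iff[OF xs, of "SOME ys. ?P ys"] same_class.refl unfolding g_def by metis
  qed
  have R: "?R = {(D, D'). D \<in> ?F \<and> D' \<in> ?F \<and> g D = g D'}"
  proof -
    have "same_class ?N D D' \<longleftrightarrow> g D = g D'" if "D \<in> ?F" "D' \<in> ?F" for D D'
      using rep[OF that(1)] rep[OF that(2)] iff g by auto
    then show ?thesis by blast
  qed
  have bij: "bij_betw (\<lambda>X. {D \<in> ?F. g D = X}) (g ` ?F) (face_classes n k)"
    unfolding bij_betw_def
  proof
    show "inj_on (\<lambda>X. {D \<in> ?F. g D = X}) (g ` ?F)" by (rule inj_onI) auto
    show "(\<lambda>X. {D \<in> ?F. g D = X}) ` g ` ?F = face_classes n k"
      unfolding face_classes_def R quotient_def by (auto simp: Image_def)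
  qed
  have img: "g ` ?F = center ` cells (n + 1) k"
  proof
    show "g ` ?F \<subseteq> center ` cells (n + 1) k"
    proof clarify
      fix D assume "D \<in> ?F"
      from rep[OF this] g show "g D \<in> center ` cells (n + 1) k" by auto
    qed
    show "center ` cells (n + 1) k \<subseteq> g ` ?F"
    proof clarify
      fix xs assume xs: "xs \<in> cells (n + 1) k"
      show "center xs \<in> g ` ?F" using g[OF xs] face[OF xs] by (metis imageI)
    qed
  qed
  have "card (face_classes n k) = card {X \<in> cell_classes (n + 1) k. shift_root X = X}"
    using bij_betw_same_card[OF bij] unfolding img center_image by simp
  then show ?thesis using card_shift_root_fixed by simp
qed

section \<open>Generating functions of weighted sets\<close>

type_synonym weight = "nat \<times> nat"

text \<open>Without this the coefficients of \<open>gf\<close> mean nothing, since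
  \<open>card\<close> of an infinite set is 0.\<close>

definition finite_fibres :: "('a \<Rightarrow> weight) \<Rightarrow> 'a set \<Rightarrow> bool" where
  "finite_fibres w S \<longleftrightarrow> (\<forall>c. finite {s \<in> S. w s = c})"

definition gf :: "('a \<Rightarrow> weight) \<Rightarrow> 'a set \<Rightarrow> fps2" where
  "gf w S = Abs_fps (\<lambda>m. Abs_fps (\<lambda>n. of_nat (card {s \<in> S. w s = (m, n)})))"

lemma gf_nth: "gf w S $ m $ n = of_nat (card {s \<in> S. w s = (m, n)})"
  by (simp add: gf_def)

lemma fps2_eqI: "(\<And>m n. f $ m $ n = g $ m $ n) \<Longrightarrow> f = (g :: fps2)"
  by (simp add: fps_eq_iff)

lemma finite_fibresD: "finite_fibres w S \<Longrightarrow> finite {s \<in> S. w s = c}"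
  unfolding finite_fibres_def by blast

lemma finite_fibres_subset: "finite_fibres w S \<Longrightarrow> T \<subseteq> S \<Longrightarrow> finite_fibres w T"
  unfolding finite_fibres_def
  by (intro allI) (rule finite_subset[of _ "{s \<in> S. w s = c}" for c], auto)

lemma gf_Un_Int:
  assumes "finite_fibres w S" "finite_fibres w T"
  shows "gf w (S \<union> T) + gf w (S \<inter> T) = gf w S + gf w T"
proof (rule fps2_eqI)
  fix m n
  let ?A = "{s \<in> S. w s = (m, n)}" and ?B = "{s \<in> T. w s = (m, n)}"
  have "{s \<in> S \<union> T. w s = (m, n)} = ?A \<union> ?B" "{s \<in> S \<inter> T. w s = (m, n)} = ?A \<inter> ?B" by auto
  moreover have "card ?A + card ?B = card (?A \<union> ?B) + card (?A \<inter> ?B)"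
    using assms by (intro card_Un_Int finite_fibresD)
  ultimately show "(gf w (S \<union> T) + gf w (S \<inter> T)) $ m $ n = (gf w S + gf w T) $ m $ n"
    by (simp add: gf_nth flip: of_nat_add)
qed

lemma gf_empty [simp]: "gf w {} = 0"
  by (rule fps2_eqI) (simp add: gf_nth)

lemma gf_disjoint_Un:
  "finite_fibres w S \<Longrightarrow> finite_fibres w T \<Longrightarrow> S \<inter> T = {} \<Longrightarrow> gf w (S \<union> T) = gf w S + gf w T"
  using gf_Un_Int[of w S T] by simp

lemma gf_bij_betw:
  assumes "bij_betw h S T" "\<And>s. s \<in> S \<Longrightarrow> v (h s) = w s"
  shows "gf v T = gf w S"
proof (rule fps2_eqI)
  fix m n
  have "bij_betw h {s \<in> S. w s = (m, n)} {t \<in> T. v t = (m, n)}"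
    using assms by (auto simp: bij_betw_def inj_on_def image_iff)
  from bij_betw_same_card[OF this] show "gf v T $ m $ n = gf w S $ m $ n"
    by (simp add: gf_nth)
qed

lemma gf_times:
  assumes "finite_fibres w S" "finite_fibres v T"
  shows "gf (\<lambda>(s, t). w s + v t) (S \<times> T) = gf w S * gf v T"
proof (rule fps2_eqI)
  fix m n :: nat
  let ?I = "{..m} \<times> {..n}"
  let ?B = "\<lambda>(i, j). {s \<in> S. w s = (i, j)} \<times> {t \<in> T. v t = (m - i, n - j)}"
  have "{p \<in> S \<times> T. (\<lambda>(s, t). w s + v t) p = (m, n)} = (\<Union>p\<in>?I. ?B p)"
  proof (intro set_eqI)
    fix p :: "'a \<times> 'b"
    obtain s t where p: "p = (s, t)" by (cases p)
    show "p \<in> {p \<in> S \<times> T. (\<lambda>(s, t). w s + v t) p = (m, n)} \<longleftrightarrow> p \<in> (\<Union>p\<in>?I. ?B p)"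
      unfolding p by (cases "w s"; cases "v t") auto
  qed
  moreover have "card (\<Union>p\<in>?I. ?B p) = (\<Sum>p\<in>?I. card (?B p))"
    using assms by (intro card_UN_disjoint) (auto intro!: finite_fibresD)
  moreover have "(\<Sum>p\<in>?I. card (?B p)) =
    (\<Sum>i\<le>m. \<Sum>j\<le>n. card {s \<in> S. w s = (i, j)} * card {t \<in> T. v t = (m - i, n - j)})"
    by (simp add: sum.cartesian_product card_cartesian_product case_prod_unfold)
  ultimately show "gf (\<lambda>(s, t). w s + v t) (S \<times> T) $ m $ n = (gf w S * gf v T) $ m $ n"
    by (simp add: gf_nth fps_mult_nth fps_sum_nth atLeast0AtMost)
qed

lemma finite_fibres_times:
  assumes "finite_fibres w S" "finite_fibres v T"
  shows "finite_fibres (\<lambda>(s, t). w s + v t) (S \<times> T)"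
  unfolding finite_fibres_def
proof
  fix c :: weight
  have "{p \<in> S \<times> T. (\<lambda>(s, t). w s + v t) p = c} \<subseteq>
    (\<Union>d\<in>{..fst c} \<times> {..snd c}. {s \<in> S. w s = d} \<times> {t \<in> T. v t = (fst c - fst d, snd c - snd d)})"
    by (auto simp: plus_prod_def mem_Times_iff)
  moreover have "finite \<dots>" using assms by (auto intro!: finite_fibresD)
  ultimately show "finite {p \<in> S \<times> T. (\<lambda>(s, t). w s + v t) p = c}" by (rule finite_subset)
qed

lemma finite_fibres_bij_betw:
  assumes "bij_betw h S T" "\<And>s. s \<in> S \<Longrightarrow> v (h s) = w s" "finite_fibres w S"
  shows "finite_fibres v T"
  unfolding finite_fibres_def
proof
  fix c
  have "{t \<in> T. v t = c} = h ` {s \<in> S. w s = c}" using assms(1,2) by (auto simp: bij_betw_def)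
  then show "finite {t \<in> T. v t = c}" using assms(3) by (simp add: finite_fibresD)
qed

lemma compose_X_power_nth:
  assumes "0 < r"
  shows "(f oo fps_X ^ r) $ n = (if r dvd n then f $ (n div r) else (0 :: 'a :: comm_ring_1))"
proof -
  have "(f oo fps_X ^ r) $ n = (\<Sum>i = 0..n. if i = n div r \<and> r dvd n then f $ i else 0)"
    unfolding fps_compose_nth power_mult[symmetric] fps_X_power_nth
    by (rule sum.cong) (use assms in auto)
  then show ?thesis by (simp add: sum.delta')
qed

lemma subst_pow_nth:
  assumes "0 < r"
  shows "subst_pow r f $ m $ n = (if r dvd m \<and> r dvd n then f $ (m div r) $ (n div r) else 0)"
  using assms by (simp add: subst_pow_def compose_X_power_nth)

lemma subst_pow_1 [simp]: "subst_pow (Suc 0) f = f"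
  by (rule fps2_eqI) (simp add: subst_pow_nth)

text \<open>The weight of r equal copies of an object, the counterpart of substituting the r-th
  powers of x and y.\<close>

definition scale_weight :: "nat \<Rightarrow> weight \<Rightarrow> weight" where
  "scale_weight r c = (r * fst c, r * snd c)"

lemma gf_scale:
  assumes "0 < r"
  shows "gf (\<lambda>s. scale_weight r (w s)) S = subst_pow r (gf w S)"
proof (rule fps2_eqI)
  fix m n
  have "{s \<in> S. scale_weight r (w s) = (m, n)} =
    (if r dvd m \<and> r dvd n then {s \<in> S. w s = (m div r, n div r)} else {})"
    using assms by (auto simp: scale_weight_def prod_eq_iff)
  then show "gf (\<lambda>s. scale_weight r (w s)) S $ m $ n = subst_pow r (gf w S) $ m $ n"
    using assms by (simp add: gf_nth subst_pow_nth)
qed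

lemma finite_fibres_scale:
  assumes "0 < r" "finite_fibres w S"
  shows "finite_fibres (\<lambda>s. scale_weight r (w s)) S"
  unfolding finite_fibres_def
proof
  fix c :: weight
  have "{s \<in> S. scale_weight r (w s) = c} \<subseteq> {s \<in> S. w s = (fst c div r, snd c div r)}"
    using assms by (auto simp: scale_weight_def)
  then show "finite {s \<in> S. scale_weight r (w s) = c}"
    using assms by (auto intro: finite_subset finite_fibresD)
qed

abbreviation list_weight :: "('a \<Rightarrow> weight) \<Rightarrow> 'a list \<Rightarrow> weight" where
  "list_weight w xs \<equiv> sum_list (map w xs)"

lemma scale_weight_simps: "scale_weight r 0 = 0" "scale_weight r (a + b) = scale_weight r a + scale_weight r b"
  by (simp_all add: scale_weight_def prod_eq_iff distrib_left)

lemma list_weight_scale: "list_weight (\<lambda>s. scale_weight r (w s)) xs = scale_weight r (list_weight w xs)"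
  by (induction xs) (simp_all add: scale_weight_simps)

lemma list_weight_replicate: "list_weight w (concat (replicate r xs)) = scale_weight r (list_weight w xs)"
  by (induction r) (simp_all add: scale_weight_def plus_prod_def prod_eq_iff)

lemma list_weight_rev [simp]: "list_weight w (rev xs) = list_weight w xs"
  by (induction xs) (simp_all add: add.commute)

lemma list_weight_rotate [simp]: "list_weight w (rotate j xs) = list_weight w xs"
proof -
  obtain us vs where "xs = us @ vs" "rotate j xs = vs @ us" using rotate_split by blast
  then show ?thesis by (simp add: add.commute)
qed

section \<open>Words, palindromes and periodic words\<close>

definition words :: "'a set \<Rightarrow> nat \<Rightarrow> 'a list set" where
  "words S k = {xs. set xs \<subseteq> S \<and> length xs = k}"

lemma words_0: "words S 0 = {[]}"
  by (auto simp: words_def)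

lemma bij_betw_Cons_words: "bij_betw (\<lambda>(x, xs). x # xs) (S \<times> words S k) (words S (Suc k))"
  by (auto simp: bij_betw_def inj_on_def words_def image_iff length_Suc_conv)

lemma gf_Nil: "gf (list_weight w) {[]} = 1"
proof (rule fps2_eqI)
  fix m n
  have "{s \<in> {[]}. list_weight w s = (m, n)} = (if m = 0 \<and> n = 0 then {[]} else {})"
    by (auto simp: zero_prod_def)
  then show "gf (list_weight w) {[]} $ m $ n = 1 $ m $ n" by (simp add: gf_nth)
qed

lemma words_gf:
  assumes "finite_fibres w S"
  shows "finite_fibres (list_weight w) (words S k) \<and> gf (list_weight w) (words S k) = gf w S ^ k"
proof (induction k)
  case 0
  then show ?case by (simp add: words_0 gf_Nil finite_fibres_def)
next
  case (Suc k)
  have w: "list_weight w (case p of (x, xs) \<Rightarrow> x # xs) = (case p of (x, xs) \<Rightarrow> w x + list_weight w xs)" for p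
    by (simp split: prod.split)
  show ?case
    using gf_bij_betw[where v = "list_weight w" and w = "\<lambda>(x, xs). w x + list_weight w xs", OF bij_betw_Cons_words w, of S k]
      finite_fibres_bij_betw[where v = "list_weight w" and w = "\<lambda>(x, xs). w x + list_weight w xs", OF bij_betw_Cons_words w, of S k]
      finite_fibres_times[OF assms, of "list_weight w" "words S k"] gf_times[OF assms, of "list_weight w" "words S k"] Suc
    by simp
qed

lemma finite_fibres_words: "finite_fibres w S \<Longrightarrow> finite_fibres (list_weight w) (words S k)"
  using words_gf by blast

lemma gf_words: "finite_fibres w S \<Longrightarrow> gf (list_weight w) (words S k) = gf w S ^ k"
  using words_gf by blast

definition palindromes :: "'a set \<Rightarrow> nat \<Rightarrow> 'a list set" where
  "palindromes S k = {xs \<in> words S k. rev xs = xs}"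

lemma finite_fibres_palindromes: "finite_fibres w S \<Longrightarrow> finite_fibres (list_weight w) (palindromes S k)"
  by (rule finite_fibres_subset[OF finite_fibres_words]) (auto simp: palindromes_def)

lemma bij_betw_palindromes:
  "bij_betw (\<lambda>(x, xs). x # xs @ [x]) (S \<times> palindromes S k) (palindromes S (Suc (Suc k)))"
  unfolding bij_betw_def
proof
  show "inj_on (\<lambda>(x, xs). x # xs @ [x]) (S \<times> palindromes S k)" by (auto simp: inj_on_def)
  show "(\<lambda>(x, xs). x # xs @ [x]) ` (S \<times> palindromes S k) = palindromes S (Suc (Suc k))"
  proof
    show "palindromes S (Suc (Suc k)) \<subseteq> (\<lambda>(x, xs). x # xs @ [x]) ` (S \<times> palindromes S k)"
    proof
      fix zs assume zs: "zs \<in> palindromes S (Suc (Suc k))"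
      then obtain x ys where ys: "zs = x # ys" "ys \<noteq> []"
        by (auto simp: palindromes_def words_def length_Suc_conv)
      then obtain xs y where xs: "ys = xs @ [y]" by (meson rev_exhaust)
      have z: "rev (x # xs @ [y]) = x # xs @ [y]" "set (x # xs @ [y]) \<subseteq> S" "length (x # xs @ [y]) = Suc (Suc k)"
        using zs unfolding ys(1) xs palindromes_def words_def by blast+
      have y: "x = y" using arg_cong[OF z(1), of hd] by simp
      have p: "rev xs = xs" "x \<in> S" "set xs \<subseteq> S" "length xs = k"
        using arg_cong[OF arg_cong[OF z(1), of tl], of butlast] z(2,3) by (simp_all add: butlast_append)
      have "(x, xs) \<in> S \<times> palindromes S k"
        unfolding palindromes_def words_def by (intro SigmaI CollectI conjI p)
      then show "zs \<in> (\<lambda>(x, xs). x # xs @ [x]) ` (S \<times> palindromes S k)"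
        unfolding ys(1) xs y[symmetric] by (rule image_eqI[rotated]) (rule prod.case[symmetric])
    qed
  qed (auto simp: palindromes_def words_def)
qed

lemma gf_palindromes_Suc_Suc:
  assumes "finite_fibres w S"
  shows "gf (list_weight w) (palindromes S (Suc (Suc k))) = subst_pow 2 (gf w S) * gf (list_weight w) (palindromes S k)"
proof -
  have "list_weight w (case p of (x, xs) \<Rightarrow> x # xs @ [x]) = (case p of (x, xs) \<Rightarrow> scale_weight 2 (w x) + list_weight w xs)" for p
    by (simp add: scale_weight_def prod_eq_iff split: prod.split)
  from gf_bij_betw[where v = "list_weight w" and w = "\<lambda>(x, xs). scale_weight 2 (w x) + list_weight w xs",
      OF bij_betw_palindromes this] show ?thesis
    using gf_times[OF finite_fibres_scale[OF _ assms, of 2] finite_fibres_palindromes[OF assms]] gf_scale[of 2 w S]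
    by simp
qed

text \<open>Equal outer letters are peeled off in pairs, each with doubled weight; a middle letter
  is left exactly for odd length.\<close>

lemma gf_palindromes:
  assumes "finite_fibres w S"
  shows "gf (list_weight w) (palindromes S k) =
    (if even k then 1 else gf w S) * subst_pow 2 (gf w S) ^ (k div 2)"
proof (induction k rule: induct_nat_012)
  case 0
  have "palindromes S 0 = {[]}" by (auto simp: palindromes_def words_0)
  then show ?case by (simp add: gf_Nil)
next
  case 1
  have "palindromes S (Suc 0) = words S (Suc 0)" by (auto simp: palindromes_def words_def length_Suc_conv)
  then show ?case using gf_words[OF assms, of 1] by simp
next
  case (ge2 k)
  then show ?case by (simp add: gf_palindromes_Suc_Suc[OF assms])
qed

text \<open>A word that commutes with \<open>u\<close> and is at least as long begins with
  \<open>u\<close>, and what remains commutes with \<open>u\<close> again.\<close>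

lemma rotate_fixed_replicate:
  assumes "0 < d" "v @ u = u @ v" "length u = d" "length v = r * d"
  shows "v = concat (replicate r u)"
  using assms(2,4)
proof (induction r arbitrary: v)
  case (Suc r)
  then have "length u \<le> length v" using assms(3) by simp
  with Suc.prems(1) obtain v' where v: "v = u @ v'"
    by (metis append_eq_append_conv_if append_take_drop_id)
  with Suc.prems have "v' @ u = u @ v'" "length v' = r * d" using assms(3) by auto
  from Suc.IH[OF this] v show ?case by simp
qed simp

lemma bij_betw_rotate_fixed:
  assumes "0 < d" "0 < r"
  shows "bij_betw (\<lambda>ys. concat (replicate r ys)) (words S d) {xs \<in> words S (r * d). rotate d xs = xs}"
proof -
  have comm: "concat (replicate r ys) @ ys = ys @ concat (replicate r ys)" for r and ys :: "'a list"
    by (induction r) auto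
  have rot: "rotate d (concat (replicate r ys)) = concat (replicate r ys)" if "length ys = d" for ys :: "'a list"
  proof -
    obtain q where "r = Suc q" using assms(2) by (cases r) auto
    then show ?thesis using rotate_append[of ys "concat (replicate q ys)"] comm[of q ys] that by simp
  qed
  have len: "length (concat (replicate r ys)) = r * length ys" for ys :: "'a list"
    by (induction r) auto
  show ?thesis
    unfolding bij_betw_def
  proof
    show "inj_on (\<lambda>ys. concat (replicate r ys)) (words S d)"
    proof (rule inj_onI)
      fix ys zs assume "ys \<in> words S d" "zs \<in> words S d" "concat (replicate r ys) = concat (replicate r zs)"
      moreover obtain q where "r = Suc q" using assms(2) by (cases r) auto
      ultimately show "ys = zs" by (auto simp: words_def)
    qed
    show "(\<lambda>ys. concat (replicate r ys)) ` words S d = {xs \<in> words S (r * d). rotate d xs = xs}"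
    proof
      show "(\<lambda>ys. concat (replicate r ys)) ` words S d \<subseteq> {xs \<in> words S (r * d). rotate d xs = xs}"
        using rot len by (auto simp: words_def)
      show "{xs \<in> words S (r * d). rotate d xs = xs} \<subseteq> (\<lambda>ys. concat (replicate r ys)) ` words S d"
      proof
        fix xs assume xs: "xs \<in> {xs \<in> words S (r * d). rotate d xs = xs}"
        obtain q where q: "r = Suc q" using assms(2) by (cases r) auto
        let ?u = "take d xs" and ?v = "drop d xs"
        have l: "length ?u = d" "length ?v = q * d" using xs q by (auto simp: words_def)
        have "?v @ ?u = xs" using rotate_append[of ?u ?v] l xs by simp
        then have "?v @ ?u = ?u @ ?v" by simp
        from rotate_fixed_replicate[OF assms(1) this l] have "xs = concat (replicate r ?u)"
          unfolding q using append_take_drop_id[of d xs] by simp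
        moreover have "?u \<in> words S d" using xs l set_take_subset[of d xs] by (auto simp: words_def)
        ultimately show "xs \<in> (\<lambda>ys. concat (replicate r ys)) ` words S d" by blast
      qed
    qed
  qed
qed

lemma gf_rotate_fixed:
  assumes "finite_fibres w S" "0 < d" "0 < r"
  shows "gf (list_weight w) {xs \<in> words S (r * d). rotate d xs = xs} = subst_pow r (gf w S) ^ d"
proof -
  have "list_weight w (concat (replicate r ys)) = list_weight (\<lambda>s. scale_weight r (w s)) ys" for ys
    by (simp only: list_weight_replicate list_weight_scale)
  from gf_bij_betw[where v = "list_weight w" and w = "list_weight (\<lambda>s. scale_weight r (w s))",
      OF bij_betw_rotate_fixed[OF assms(2,3)] this] show ?thesis
    by (simp only: gf_words[OF finite_fibres_scale[OF assms(3,1)]] gf_scale[OF assms(3)])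
qed

lemma rotate_mult_fixed: "rotate j xs = xs \<Longrightarrow> rotate (t * j) xs = xs"
  by (induction t) (simp_all flip: rotate_rotate)

text \<open>By Bezout a multiple of \<open>j\<close> is congruent to the gcd modulo
  \<open>k\<close>, and rotations of a list of length \<open>k\<close> depend on the amount modulo
  \<open>k\<close> only.\<close>

lemma rotate_gcd_fixed:
  assumes "0 < j" "length xs = k"
  shows "rotate j xs = xs \<longleftrightarrow> rotate (gcd j k) xs = xs"
proof
  assume j: "rotate j xs = xs"
  obtain x y where "j * x = k * y + gcd j k" using bezout_nat[of j k] assms by auto
  then have "rotate (gcd j k) xs = rotate (x * j) xs"
    using assms(2) rotate_conv_mod[of "x * j" xs] rotate_conv_mod[of "gcd j k" xs] by (simp add: mult.commute)
  then show "rotate (gcd j k) xs = xs" using rotate_mult_fixed[OF j] by simp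
next
  assume "rotate (gcd j k) xs = xs"
  from rotate_mult_fixed[OF this, of "j div gcd j k"] show "rotate j xs = xs" by simp
qed

lemma gf_rotations:
  assumes "finite_fibres w S" "0 < k"
  shows "(\<Sum>j<k. gf (list_weight w) {xs \<in> words S k. rotate j xs = xs}) =
    (\<Sum>r | r dvd k. of_nat (totient r) * subst_pow r (gf w S) ^ (k div r))"
proof -
  let ?g = "\<lambda>j. gf (list_weight w) {xs \<in> words S k. rotate j xs = xs}"
  have "{..<k} = insert 0 {0<..<k}" "{0<..k} = insert k {0<..<k}" using assms(2) by auto
  moreover have "rotate k xs = rotate 0 xs" if "xs \<in> words S k" for xs :: "'a list"
    using that rotate_id[of k xs] by (simp add: words_def)
  then have "?g k = ?g 0" by (metis (no_types, lifting))
  \<comment> \<open>The identity is indexed by \<open>k\<close> instead of 0, to match the range in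
    which the totient counts numbers with a given gcd.\<close>
  ultimately have "(\<Sum>j<k. ?g j) = (\<Sum>j\<in>{0<..k}. ?g j)" by simp
  also have "\<dots> = (\<Sum>j\<in>{0<..k}. ?g (gcd j k))"
  proof (rule sum.cong[OF HOL.refl])
    fix j assume "j \<in> {0<..k}"
    then have "{xs \<in> words S k. rotate j xs = xs} = {xs \<in> words S k. rotate (gcd j k) xs = xs}"
      using rotate_gcd_fixed by (auto simp: words_def)
    then show "?g j = ?g (gcd j k)" by simp
  qed
  also have "\<dots> = (\<Sum>d | d dvd k. \<Sum>j | j \<in> {0<..k} \<and> gcd j k = d. ?g (gcd j k))"
    by (rule sum.group[symmetric]) (use assms(2) in auto)
  also have "\<dots> = (\<Sum>d | d dvd k. of_nat (totient (k div d)) * ?g d)"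
  proof (rule sum.cong[OF HOL.refl])
    fix d assume "d \<in> {d. d dvd k}"
    have "(\<Sum>j | j \<in> {0<..k} \<and> gcd j k = d. ?g (gcd j k)) = (\<Sum>j | j \<in> {0<..k} \<and> gcd j k = d. ?g d)"
      by (rule sum.cong) auto
    then show "(\<Sum>j | j \<in> {0<..k} \<and> gcd j k = d. ?g (gcd j k)) = of_nat (totient (k div d)) * ?g d"
      using card_gcd_eq_totient[of k d] assms(2) \<open>d \<in> {d. d dvd k}\<close> by simp
  qed
  also have "\<dots> = (\<Sum>d | d dvd k. of_nat (totient (k div d)) * subst_pow (k div d) (gf w S) ^ d)"
  proof (rule sum.cong[OF HOL.refl])
    fix d assume "d \<in> {d. d dvd k}"
    then have "0 < d" "0 < k div d" "k div d * d = k" using assms(2) by (auto elim!: dvdE)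
    with gf_rotate_fixed[OF assms(1) this(1,2)]
    show "of_nat (totient (k div d)) * ?g d = of_nat (totient (k div d)) * subst_pow (k div d) (gf w S) ^ d"
      by simp
  qed
  also have "\<dots> = (\<Sum>r | r dvd k. of_nat (totient r) * subst_pow r (gf w S) ^ (k div r))"
    by (rule sum.reindex_bij_witness[of _ "\<lambda>r. k div r" "\<lambda>r. k div r"])
      (use assms(2) in \<open>auto elim!: dvdE simp: div_mult2_eq\<close>)
  finally show ?thesis .
qed

section \<open>Counting dihedral orbits\<close>

lemma rotate1_rev_rotate1: "rotate1 (rev (rotate1 xs)) = rev xs"
  by (cases xs) auto

lemma list_weight_rotate1 [simp]: "list_weight w (rotate1 xs) = list_weight w xs"
  by (cases xs) (simp_all add: add.commute)

lemma words_rotate1 [simp]: "rotate1 xs \<in> words S k \<longleftrightarrow> xs \<in> words S k"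
  by (simp add: words_def)

text \<open>Conjugating a reflection with a one-step rotation raises its index by two, so the count
  of its fixed words depends on the parity of the index only.\<close>

lemma rotate_rev_rotate1: "rotate (Suc (Suc j)) (rev (rotate1 xs)) = rotate1 (rotate j (rev xs))"
  using rotate_rotate[of "Suc j" 1 "rev (rotate1 xs)"]
  by (simp add: rotate1_rev_rotate1 rotate1_rotate_swap)

definition reflection_fixed :: "'a set \<Rightarrow> nat \<Rightarrow> nat \<Rightarrow> 'a list set" where
  "reflection_fixed S k j = {xs \<in> words S k. rotate j (rev xs) = xs}"

lemma gf_reflection_Suc_Suc:
  "gf (list_weight w) (reflection_fixed S k (Suc (Suc j))) = gf (list_weight w) (reflection_fixed S k j)"
proof (rule gf_bij_betw[where h = rotate1])
  have inj: "rotate1 xs = rotate1 ys \<longleftrightarrow> xs = ys" for xs ys :: "'a list"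
    using inj_rotate1 by (auto dest: injD)
  show "bij_betw rotate1 (reflection_fixed S k j) (reflection_fixed S k (Suc (Suc j)))"
    unfolding bij_betw_def
  proof
    show "inj_on rotate1 (reflection_fixed S k j)" using inj by (auto simp: inj_on_def)
    show "rotate1 ` reflection_fixed S k j = reflection_fixed S k (Suc (Suc j))"
    proof
      show "reflection_fixed S k (Suc (Suc j)) \<subseteq> rotate1 ` reflection_fixed S k j"
      proof
        fix ys assume ys: "ys \<in> reflection_fixed S k (Suc (Suc j))"
        obtain xs where "ys = rotate1 xs" using surj_rotate1 by (metis surjD)
        with ys show "ys \<in> rotate1 ` reflection_fixed S k j"
          unfolding reflection_fixed_def by (auto simp only: mem_Collect_eq rotate_rev_rotate1 inj words_rotate1)
      qed
      show "rotate1 ` reflection_fixed S k j \<subseteq> reflection_fixed S k (Suc (Suc j))"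
        unfolding reflection_fixed_def by (auto simp only: mem_Collect_eq rotate_rev_rotate1 inj words_rotate1)
    qed
  qed
qed simp

lemma reflection_fixed_0: "reflection_fixed S k 0 = palindromes S k"
  by (simp add: reflection_fixed_def palindromes_def)

text \<open>\<open>rotate 1 (rev (xs @ [x]))\<close> is \<open>rev xs @ [x]\<close>: the axis passes
  through the last side, and the other letters form a palindrome.\<close>

lemma gf_reflection_1:
  assumes "finite_fibres w S"
  shows "gf (list_weight w) (reflection_fixed S (Suc k) 1) = gf w S * gf (list_weight w) (palindromes S k)"
proof -
  have w: "list_weight w (case p of (x, xs) \<Rightarrow> xs @ [x]) = (case p of (x, xs) \<Rightarrow> w x + list_weight w xs)" for p
    by (simp add: add.commute split: prod.split)
  have "bij_betw (\<lambda>(x, xs). xs @ [x]) (S \<times> palindromes S k) (reflection_fixed S (Suc k) 1)"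
    unfolding bij_betw_def
  proof
    show "inj_on (\<lambda>(x, xs). xs @ [x]) (S \<times> palindromes S k)" by (auto simp: inj_on_def)
    show "(\<lambda>(x, xs). xs @ [x]) ` (S \<times> palindromes S k) = reflection_fixed S (Suc k) 1"
    proof
      show "reflection_fixed S (Suc k) 1 \<subseteq> (\<lambda>(x, xs). xs @ [x]) ` (S \<times> palindromes S k)"
      proof
        fix zs assume zs: "zs \<in> reflection_fixed S (Suc k) 1"
        then have "zs \<noteq> []" by (auto simp: reflection_fixed_def words_def)
        then obtain xs x where x: "zs = xs @ [x]" by (meson rev_exhaust)
        have "rev xs = xs" "x \<in> S" "set xs \<subseteq> S" "length xs = k"
          using zs unfolding x reflection_fixed_def words_def by simp_all
        then have "(x, xs) \<in> S \<times> palindromes S k"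
          unfolding palindromes_def words_def by blast
        then show "zs \<in> (\<lambda>(x, xs). xs @ [x]) ` (S \<times> palindromes S k)"
          unfolding x by (rule image_eqI[rotated]) simp
      qed
    qed (auto simp: palindromes_def words_def reflection_fixed_def)
  qed
  from gf_bij_betw[where v = "list_weight w" and w = "\<lambda>(x, xs). w x + list_weight w xs", OF this w]
  show ?thesis using gf_times[OF assms finite_fibres_palindromes[OF assms]] by simp
qed

lemma gf_reflection_even: "gf (list_weight w) (reflection_fixed S k (2 * j)) = gf (list_weight w) (palindromes S k)"
  by (induction j) (simp_all add: reflection_fixed_0 gf_reflection_Suc_Suc)

lemma gf_reflection_odd:
  "gf (list_weight w) (reflection_fixed S k (Suc (2 * j))) = gf (list_weight w) (reflection_fixed S k 1)"
  by (induction j) (simp_all add: gf_reflection_Suc_Suc)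

lemma reflection_fixed_add: "reflection_fixed S k (j + k) = reflection_fixed S k j"
proof -
  have "rotate (j + k) (rev xs) = rotate j (rev xs)" if "xs \<in> words S k" for xs :: "'a list"
    using that rotate_conv_mod[of "j + k" "rev xs"] rotate_conv_mod[of j "rev xs"] by (simp add: words_def)
  then show ?thesis by (auto simp: reflection_fixed_def)
qed

lemma sum_lessThan_double:
  "(\<Sum>j<2 * n. f j) = (\<Sum>j<n. f (2 * j) + f (Suc (2 * j)) :: 'a :: comm_monoid_add)"
  by (induction n) (simp_all add: ac_simps)

text \<open>For even \<open>k\<close>, half of the axes pass through two corners (even index, plain
  palindromes) and half through two sides (odd index, two free letters). For odd \<open>k\<close>,
  adding \<open>k\<close> changes the parity of the index, so all reflections count alike.\<close>

lemma gf_reflections: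
  assumes "finite_fibres w S" "0 < k"
  shows "(\<Sum>j<k. gf (list_weight w) (reflection_fixed S k j)) =
    (if even k then of_nat (k div 2) * ((gf w S)\<^sup>2 * subst_pow 2 (gf w S) ^ (k div 2 - 1) + subst_pow 2 (gf w S) ^ (k div 2))
     else of_nat k * (gf w S * subst_pow 2 (gf w S) ^ (k div 2)))"
proof (cases "even k")
  case True
  then obtain q where k: "k = 2 * Suc q" using assms(2) by (metis evenE gr0_implies_Suc nat_0_less_mult_iff)
  have "(\<Sum>j<k. gf (list_weight w) (reflection_fixed S k j)) =
      of_nat (Suc q) * (gf (list_weight w) (palindromes S k) + gf (list_weight w) (reflection_fixed S k 1))"
    unfolding k sum_lessThan_double gf_reflection_even gf_reflection_odd by simp
  also have "gf (list_weight w) (reflection_fixed S k 1) = gf w S * (gf w S * subst_pow 2 (gf w S) ^ q)"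
    using gf_reflection_1[OF assms(1), of "Suc (2 * q)"] gf_palindromes[OF assms(1), of "Suc (2 * q)"]
    by (simp add: k)
  finally show ?thesis
    using True gf_palindromes[OF assms(1), of k] by (simp add: k power2_eq_square algebra_simps)
next
  case False
  have "gf (list_weight w) (reflection_fixed S k j) = gf (list_weight w) (palindromes S k)" for j
  proof (cases "even j")
    case True
    then show ?thesis using gf_reflection_even by (metis evenE)
  next
    case odd: False
    then obtain i where "j + k = 2 * i" using False by (metis evenE odd_even_add)
    then show ?thesis using gf_reflection_even reflection_fixed_add by metis
  qed
  then show ?thesis using False gf_palindromes[OF assms(1), of k] by simp
qed

text \<open>Burnside's lemma without a group: \<open>I\<close> merely indexes maps, and
  \<open>stab\<close> replaces the coset argument by demanding that all indices with the same image
  of x form a set as large as the stabiliser of x.\<close>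

lemma burnside_count:
  fixes act :: "'g \<Rightarrow> 'x \<Rightarrow> 'x"
  assumes fin: "finite I" "finite X"
    and orb: "\<And>x. x \<in> X \<Longrightarrow> orb x = (\<lambda>g. act g x) ` I" "\<And>x. x \<in> X \<Longrightarrow> orb x \<subseteq> X"
    and refl: "\<And>x. x \<in> X \<Longrightarrow> x \<in> orb x"
    and eq: "\<And>x y. x \<in> X \<Longrightarrow> y \<in> orb x \<Longrightarrow> orb y = orb x"
    and stab: "\<And>x h. x \<in> X \<Longrightarrow> h \<in> I \<Longrightarrow> card {g \<in> I. act g x = act h x} = card {g \<in> I. act g x = x}"
  shows "card I * card (orb ` X) = (\<Sum>g\<in>I. card {x \<in> X. act g x = x})"
proof -
  define st where "st x = card {g \<in> I. act g x = x}" for x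
  have finorb: "finite (orb x)" if "x \<in> X" for x using orb(1)[OF that] fin by simp
  have orbit_stabilizer: "card (orb x) * st x = card I" if x: "x \<in> X" for x
  proof -
    have "card I = (\<Sum>g\<in>I. 1)" by simp
    also have "\<dots> = (\<Sum>y\<in>orb x. \<Sum>g | g \<in> I \<and> act g x = y. 1)"
      unfolding orb(1)[OF x] by (rule sum.image_gen[OF fin(1)])
    also have "\<dots> = (\<Sum>y\<in>orb x. st x)"
      by (rule sum.cong) (use orb(1)[OF x] stab[OF x] in \<open>auto simp: st_def\<close>)
    finally show ?thesis by simp
  qed
  have "(\<Sum>g\<in>I. card {x \<in> X. act g x = x}) = (\<Sum>g\<in>I. \<Sum>x\<in>X. if act g x = x then 1 else 0)"
    using fin by (intro sum.cong) (auto simp: sum.If_cases Int_def)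
  also have "\<dots> = (\<Sum>x\<in>X. \<Sum>g\<in>I. if act g x = x then 1 else 0)" by (rule sum.swap)
  also have "\<dots> = (\<Sum>x\<in>X. st x)"
    using fin by (intro sum.cong) (auto simp: sum.If_cases Int_def st_def)
  also have "\<dots> = (\<Sum>Q\<in>orb ` X. \<Sum>x | x \<in> X \<and> orb x = Q. st x)"
    by (rule sum.image_gen[OF fin(2)])
  also have "\<dots> = (\<Sum>Q\<in>orb ` X. card I)"
  proof (rule sum.cong[OF HOL.refl])
    fix Q assume "Q \<in> orb ` X"
    then obtain x where x: "x \<in> X" "Q = orb x" by blast
    have "{y \<in> X. orb y = Q} = orb x" using x refl eq orb(2) by blast
    moreover have "st y = card I div card (orb x)" if "y \<in> orb x" for y
    proof -
      have "y \<in> X" "orb y = orb x" using that x orb(2) eq by blast+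
      moreover have "card (orb x) \<noteq> 0" using finorb[OF x(1)] refl[OF x(1)] by auto
      ultimately show ?thesis using orbit_stabilizer[of y] by (metis nonzero_mult_div_cancel_left)
    qed
    ultimately have "(\<Sum>x | x \<in> X \<and> orb x = Q. st x) = card (orb x) * (card I div card (orb x))"
      by simp
    also have "\<dots> = card I" using orbit_stabilizer[OF x(1)] by (metis dvd_mult_div_cancel dvd_triv_left)
    finally show "(\<Sum>x | x \<in> X \<and> orb x = Q. st x) = card I" .
  qed
  finally show ?thesis by simp
qed

text \<open>A pair names one of the 2k elements of the dihedral group; pairs with the same effect on
  a word stay distinct, as the cycle index requires.\<close>

definition dihedral_act :: "nat \<times> bool \<Rightarrow> 'a list \<Rightarrow> 'a list" where
  "dihedral_act g xs = rotate (fst g) (if snd g then rev xs else xs)"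

lemma rotate_eq_iff: "rotate n xs = rotate n ys \<longleftrightarrow> xs = ys"
  by (induction n) (auto dest: injD[OF inj_rotate1])

lemma dihedral_orbit_act:
  assumes "length xs = k" "0 < k"
  shows "dihedral_orbit xs = (\<lambda>g. dihedral_act g xs) ` ({..<k} \<times> UNIV)"
proof -
  have *: "range (\<lambda>j. rotate j ys) = (\<lambda>j. rotate j ys) ` {..<k}" if "length ys = k" for ys :: "'a list"
  proof
    show "range (\<lambda>j. rotate j ys) \<subseteq> (\<lambda>j. rotate j ys) ` {..<k}"
    proof clarify
      fix j
      show "rotate j ys \<in> (\<lambda>j. rotate j ys) ` {..<k}"
        using that assms(2) rotate_conv_mod[of j ys] by (intro image_eqI[of _ _ "j mod k"]) auto
    qed
  qed auto
  have "{..<k} \<times> (UNIV :: bool set) = (\<lambda>j. (j, False)) ` {..<k} \<union> (\<lambda>j. (j, True)) ` {..<k}"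
    by (auto simp: UNIV_bool)
  then show ?thesis
    unfolding dihedral_orbit_def using *[of xs] *[of "rev xs"] assms(1)
    by (simp add: image_Un image_image dihedral_act_def)
qed

lemma rotate_diff_rotate:
  assumes "length xs = k" "l < k"
  shows "rotate (k - l) (rotate l xs) = xs" "rotate l (rotate (k - l) xs) = xs"
  using assms by (simp_all add: rotate_rotate)

lemma rotate_mod_length: "length xs = k \<Longrightarrow> rotate (n mod k) xs = rotate n xs"
  using rotate_conv_mod[of n xs] by simp

lemma rev_rotate_less: "length xs = k \<Longrightarrow> j < k \<Longrightarrow> rev (rotate j xs) = rotate (k - j) (rev xs)"
  by (simp add: rev_rotate)

text \<open>Composition with the inverse of \<open>h\<close> is a bijection between the two sets; it
  is written out on indices, separately for a rotation and a reflection.\<close>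

lemma card_dihedral_act_eq:
  assumes "length xs = k" "h \<in> {..<k} \<times> UNIV"
  shows "card {g \<in> {..<k} \<times> UNIV. dihedral_act g xs = dihedral_act h xs} =
    card {g \<in> {..<k} \<times> UNIV. dihedral_act g xs = xs}"
proof -
  obtain l c where h: "h = (l, c)" "l < k" using assms(2) by auto
  let ?r = "\<lambda>b. if b then rev xs else xs"
  have len: "length (?r b) = k" for b using assms(1) by simp
  show ?thesis
  proof (cases c)
    case False
    have key: "rotate ((j + (k - l)) mod k) (?r b) = xs \<longleftrightarrow> rotate j (?r b) = rotate l xs" for j b
    proof -
      have "rotate ((j + (k - l)) mod k) (?r b) = rotate (k - l) (rotate j (?r b))"
        unfolding rotate_mod_length[OF len] by (simp add: rotate_rotate add.commute)
      then show ?thesis using rotate_diff_rotate(1)[OF assms(1) h(2)] rotate_eq_iff by metis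
    qed
    have inv: "((j + l) mod k + (k - l)) mod k = j" if "j < k" for j
    proof -
      have "((j + l) mod k + (k - l)) mod k = (j + l + (k - l)) mod k"
        by (rule mod_add_left_eq)
      also have "j + l + (k - l) = j + k" using h(2) by simp
      finally show ?thesis using that by simp
    qed
    have "bij_betw (\<lambda>(j, b). ((j + (k - l)) mod k, b))
      {g \<in> {..<k} \<times> UNIV. dihedral_act g xs = dihedral_act h xs} {g \<in> {..<k} \<times> UNIV. dihedral_act g xs = xs}"
    proof (rule bij_betw_byWitness[where f' = "\<lambda>(j, b). ((j + l) mod k, b)"])
      show "(\<lambda>(j, b). ((j + (k - l)) mod k, b)) ` {g \<in> {..<k} \<times> UNIV. dihedral_act g xs = dihedral_act h xs}
        \<subseteq> {g \<in> {..<k} \<times> UNIV. dihedral_act g xs = xs}"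
        using key h False by (fastforce simp: dihedral_act_def)
      show "(\<lambda>(j, b). ((j + l) mod k, b)) ` {g \<in> {..<k} \<times> UNIV. dihedral_act g xs = xs}
        \<subseteq> {g \<in> {..<k} \<times> UNIV. dihedral_act g xs = dihedral_act h xs}"
      proof (rule image_subsetI)
        fix g assume "g \<in> {g \<in> {..<k} \<times> UNIV. dihedral_act g xs = xs}"
        then obtain j b where j: "g = (j, b)" "j < k" "dihedral_act (j, b) xs = xs" by (cases g) auto
        from inv[OF j(2)] show "(case g of (j, b) \<Rightarrow> ((j + l) mod k, b)) \<in>
            {g \<in> {..<k} \<times> UNIV. dihedral_act g xs = dihedral_act h xs}"
          using key[of "(j + l) mod k" b] j h False by (simp add: dihedral_act_def)
      qed
    qed (use h inv in \<open>auto simp: mod_simps\<close>)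
    then show ?thesis by (rule bij_betw_same_card)
  next
    case True
    \<comment> \<open>A reflection is its own inverse, and composing it with (j, b) gives l - j
      modulo \<open>k\<close> with the flag negated. This map of the indices is an
      involution.\<close>
    have key: "rotate ((l + (k - j)) mod k) (?r (\<not> b)) = xs \<longleftrightarrow> rotate j (?r b) = rotate l (rev xs)"
      if "j < k" for j b
    proof -
      have "rotate ((l + (k - j)) mod k) (?r (\<not> b)) = rotate l (rotate (k - j) (?r (\<not> b)))"
        unfolding rotate_mod_length[OF len] by (simp add: rotate_rotate)
      also have "rotate (k - j) (?r (\<not> b)) = rev (rotate j (?r b))"
        using rev_rotate_less[OF len that] by auto
      finally have "rotate ((l + (k - j)) mod k) (?r (\<not> b)) = xs \<longleftrightarrow> rotate l (rev (rotate j (?r b))) = rotate l (rotate (k - l) xs)"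
        using rotate_diff_rotate(2)[OF assms(1) h(2)] by simp
      also have "rotate (k - l) xs = rev (rotate l (rev xs))"
        using rev_rotate_less[of "rev xs" k l] assms(1) h(2) by simp
      finally show ?thesis by (simp add: rotate_eq_iff)
    qed
    have inv: "(l + (k - (l + (k - j)) mod k)) mod k = j" if "j < k" for j
    proof (cases "j \<le> l")
      case True
      then have "l + (k - j) = k + (l - j)" "l - j < k" using that h(2) by auto
      then have "(l + (k - j)) mod k = l - j" by simp
      moreover have "l + (k - (l - j)) = k + j" using True h(2) by simp
      ultimately show ?thesis using that by simp
    next
      case False
      then have "(l + (k - j)) mod k = l + (k - j)" using that by simp
      moreover have "l + (k - (l + (k - j))) = j" using False that by simp
      ultimately show ?thesis using that by simp
    qed
    have sub: "(\<lambda>(j, b). ((l + (k - j)) mod k, \<not> b)) ` {g \<in> {..<k} \<times> UNIV. dihedral_act g xs = dihedral_act h xs}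
        \<subseteq> {g \<in> {..<k} \<times> UNIV. dihedral_act g xs = xs}"
    proof (rule image_subsetI)
      fix g assume "g \<in> {g \<in> {..<k} \<times> UNIV. dihedral_act g xs = dihedral_act h xs}"
      then obtain j b where j: "g = (j, b)" "j < k" "dihedral_act (j, b) xs = dihedral_act h xs" by (cases g) auto
      then show "(case g of (j, b) \<Rightarrow> ((l + (k - j)) mod k, \<not> b)) \<in> {g \<in> {..<k} \<times> UNIV. dihedral_act g xs = xs}"
        using key[of j b] h True by (simp add: dihedral_act_def)
    qed
    have sub': "(\<lambda>(j, b). ((l + (k - j)) mod k, \<not> b)) ` {g \<in> {..<k} \<times> UNIV. dihedral_act g xs = xs}
        \<subseteq> {g \<in> {..<k} \<times> UNIV. dihedral_act g xs = dihedral_act h xs}"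
    proof (rule image_subsetI)
      fix g assume "g \<in> {g \<in> {..<k} \<times> UNIV. dihedral_act g xs = xs}"
      then obtain j b where j: "g = (j, b)" "j < k" "dihedral_act (j, b) xs = xs" by (cases g) auto
      then show "(case g of (j, b) \<Rightarrow> ((l + (k - j)) mod k, \<not> b)) \<in>
          {g \<in> {..<k} \<times> UNIV. dihedral_act g xs = dihedral_act h xs}"
        using key[of "(l + (k - j)) mod k" "\<not> b"] inv[of j] h True by (simp add: dihedral_act_def)
    qed
    have "bij_betw (\<lambda>(j, b). ((l + (k - j)) mod k, \<not> b))
      {g \<in> {..<k} \<times> UNIV. dihedral_act g xs = dihedral_act h xs} {g \<in> {..<k} \<times> UNIV. dihedral_act g xs = xs}"
      by (rule bij_betw_byWitness[OF _ _ sub sub']) (use inv in auto)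
    then show ?thesis by (rule bij_betw_same_card)
  qed
qed

lemma card_dihedral_orbits:
  assumes "finite_fibres w S" "0 < k"
  shows "2 * k * card (dihedral_orbit ` {xs \<in> words S k. list_weight w xs = c}) =
    (\<Sum>j<k. card {xs \<in> {xs \<in> words S k. rotate j xs = xs}. list_weight w xs = c}) +
    (\<Sum>j<k. card {xs \<in> reflection_fixed S k j. list_weight w xs = c})"
proof -
  let ?X = "{xs \<in> words S k. list_weight w xs = c}" and ?I = "{..<k} \<times> (UNIV :: bool set)"
  have "card ?I * card (dihedral_orbit ` ?X) = (\<Sum>g\<in>?I. card {xs \<in> ?X. dihedral_act g xs = xs})"
  proof (rule burnside_count)
    show "finite ?X" using finite_fibres_words[OF assms(1)] by (rule finite_fibresD)
    show "dihedral_orbit xs = (\<lambda>g. dihedral_act g xs) ` ?I" if "xs \<in> ?X" for xs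
      using that assms(2) by (intro dihedral_orbit_act) (auto simp: words_def)
    show "dihedral_orbit xs \<subseteq> ?X" if "xs \<in> ?X" for xs
      using that by (auto simp: dihedral_orbit_def words_def)
    show "card {g \<in> ?I. dihedral_act g xs = dihedral_act h xs} = card {g \<in> ?I. dihedral_act g xs = xs}"
      if "xs \<in> ?X" "h \<in> ?I" for xs h
      using that by (intro card_dihedral_act_eq) (auto simp: words_def)
  qed (simp_all add: dihedral_orbit_refl dihedral_orbit_eq)
  also have "\<dots> = (\<Sum>j<k. \<Sum>b\<in>UNIV. card {xs \<in> ?X. dihedral_act (j, b) xs = xs})"
    by (subst sum.cartesian_product) simp
  also have "\<dots> = (\<Sum>j<k. card {xs \<in> ?X. rotate j xs = xs} + card {xs \<in> ?X. rotate j (rev xs) = xs})"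
    by (simp add: UNIV_bool dihedral_act_def add.commute)
  also have "\<dots> = (\<Sum>j<k. card {xs \<in> ?X. rotate j xs = xs}) + (\<Sum>j<k. card {xs \<in> ?X. rotate j (rev xs) = xs})"
    by (rule sum.distrib)
  finally have eq: "card ?I * card (dihedral_orbit ` ?X) =
    (\<Sum>j<k. card {xs \<in> ?X. rotate j xs = xs}) + (\<Sum>j<k. card {xs \<in> ?X. rotate j (rev xs) = xs})" .
  have "{xs \<in> ?X. rotate j xs = xs} = {xs \<in> {xs \<in> words S k. rotate j xs = xs}. list_weight w xs = c}"
    and "{xs \<in> ?X. rotate j (rev xs) = xs} = {xs \<in> reflection_fixed S k j. list_weight w xs = c}" for j
    by (auto simp: reflection_fixed_def)
  with eq show ?thesis by (simp only: card_cartesian_product card_lessThan card_UNIV_bool mult.commute)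
qed

lemma const2_simps:
  "const2 a * const2 b = const2 (a * b)" "const2 a + const2 b = const2 (a + b)" "const2 1 = 1"
  "of_nat k = const2 (of_nat k)" "const2 0 = 0"
  by (simp_all add: const2_def fps_of_nat flip: fps_const_mult fps_const_add)

lemma const2_mult_nth: "(const2 c * f) $ m $ n = c * f $ m $ n"
  by (simp add: const2_def)

lemma cycle_index_dihedral_nth:
  assumes "finite_fibres w S" "0 < k"
  shows "cycle_index_dihedral k (\<lambda>r. subst_pow r (gf w S)) $ m $ n =
    of_nat (card (dihedral_orbit ` {xs \<in> words S k. list_weight w xs = (m, n)}))"
proof -
  let ?s = "\<lambda>r. subst_pow r (gf w S)"
  let ?rot = "\<Sum>j<k. gf (list_weight w) {xs \<in> words S k. rotate j xs = xs}"
    and ?ref = "\<Sum>j<k. gf (list_weight w) (reflection_fixed S k j)"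
  have "cycle_index_dihedral k ?s = const2 (1 / (2 * of_nat k)) * ?rot + const2 (1 / (2 * of_nat k)) * ?ref"
  proof (cases "even k")
    case True
    \<comment> \<open>Each kind of reflection occurs k/2 times, which turns 1/(2k) into the
      coefficient 1/4.\<close>
    then have "of_nat (k div 2) = (of_nat k / 2 :: rat)" by (auto elim: evenE)
    then have "1 / (2 * of_nat k) * of_nat (k div 2) = (1 / 4 :: rat)"
      using assms(2) by simp
    then have "const2 (1 / (2 * of_nat k)) * of_nat (k div 2) = const2 (1 / 4)"
      by (simp only: const2_simps)
    then have "const2 (1 / 4) * f = const2 (1 / (2 * of_nat k)) * (of_nat (k div 2) * f)" for f
      by (metis mult.assoc)
    then show ?thesis
      unfolding cycle_index_dihedral_def gf_rotations[OF assms] gf_reflections[OF assms]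
      using True by (simp del: of_nat_numeral)
  next
    case False
    have "const2 (1 / 2) = const2 (1 / (2 * of_nat k)) * of_nat k"
      using assms(2) by (simp add: const2_simps)
    then have *: "const2 (1 / 2) * f * g = const2 (1 / (2 * of_nat k)) * (of_nat k * (f * g))" for f g
      by (simp only: mult.assoc)
    then show ?thesis
      unfolding cycle_index_dihedral_def gf_rotations[OF assms] gf_reflections[OF assms]
      by (simp only: False if_False * One_nat_def subst_pow_1 distrib_left)
  qed
  then have "cycle_index_dihedral k ?s $ m $ n = 1 / (2 * of_nat k) * (?rot $ m $ n + ?ref $ m $ n)"
    by (simp only: fps_add_nth const2_mult_nth distrib_left)
  also have "?rot $ m $ n + ?ref $ m $ n =
    of_nat (2 * k * card (dihedral_orbit ` {xs \<in> words S k. list_weight w xs = (m, n)}))"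
    unfolding card_dihedral_orbits[OF assms] by (simp add: fps_sum_nth gf_nth)
  finally show ?thesis using assms(2) by simp
qed

section \<open>The generating function of planted trees\<close>

text \<open>The coefficients are power series and do not form a field, so the leading one must
  itself be a unit: its constant term has to be nonzero.\<close>

lemma fps2_mult_inverse:
  fixes g :: fps2
  assumes "g $ 0 $ 0 \<noteq> 0"
  shows "g * inverse g = 1"
proof -
  have "g $ 0 * inverse (g $ 0) = 1" using assms by (rule inverse_mult_eq_1')
  then show ?thesis by (subst fps_inverse_def) (rule fps_right_inverse)
qed

lemma fps2_divide:
  fixes f g :: fps2
  assumes "g $ 0 $ 0 \<noteq> 0"
  shows "f / g = f * inverse g"
  using assms by (intro fps_divide_unit) auto

lemma fps2_divide_eqI:
  fixes f g h :: fps2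
  assumes "g $ 0 $ 0 \<noteq> 0" "f = h * g"
  shows "f / g = h"
  using fps2_mult_inverse[OF assms(1)] by (simp add: fps2_divide assms mult.assoc)

text \<open>Congruence modulo \<open>x\<^sup>n\<close>; the factor \<open>x\<close> in the equation of \<open>A\<close> makes it a contraction.\<close>

definition agree :: "nat \<Rightarrow> fps2 \<Rightarrow> fps2 \<Rightarrow> bool" where
  "agree n f g \<longleftrightarrow> (\<forall>i<n. f $ i = g $ i)"

lemma agree_refl [simp]: "agree n f f"
  by (simp add: agree_def)

lemma agree_sym: "agree n f g \<Longrightarrow> agree n g f"
  by (simp add: agree_def)

lemma agree_add: "agree n f f' \<Longrightarrow> agree n g g' \<Longrightarrow> agree n (f + g) (f' + g')"
  by (simp add: agree_def)

lemma agree_diff: "agree n f f' \<Longrightarrow> agree n g g' \<Longrightarrow> agree n (f - g) (f' - g')"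
  by (simp add: agree_def)

lemma agree_mult: "agree n f f' \<Longrightarrow> agree n g g' \<Longrightarrow> agree n (f * g) (f' * g')"
  unfolding agree_def fps_mult_nth by (auto intro!: sum.cong)

lemma agree_var_x_mult: "agree n f g \<Longrightarrow> agree (Suc n) (var_x * f) (var_x * g)"
  by (auto simp: agree_def var_x_def)

lemma agree_subst_pow:
  assumes "0 < r" "agree n f g"
  shows "agree n (subst_pow r f) (subst_pow r g)"
  unfolding agree_def
proof (intro allI impI)
  fix i assume "i < n"
  then have "i div r < n" by (meson div_le_dividend le_less_trans)
  then show "subst_pow r f $ i = subst_pow r g $ i"
    using assms by (intro fps_ext) (simp add: subst_pow_nth agree_def)
qed

lemma agree_divide:
  assumes "g $ 0 $ 0 \<noteq> 0" "g' $ 0 $ 0 \<noteq> 0" "agree n f f'" "agree n g g'"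
  shows "agree n (f / g) (f' / g')"
proof -
  \<comment> \<open>Both inverses are written as products that differ only in having g' or g as
    middle factor.\<close>
  have "inverse g * (g' * inverse g') = inverse g"
    using fps2_mult_inverse[OF assms(2)] by simp
  moreover have "inverse g * (g * inverse g') = inverse g'"
    using fps2_mult_inverse[OF assms(1)] by (simp add: mult.assoc[symmetric] mult.commute[of "inverse g" g])
  moreover have "agree n (inverse g * (g' * inverse g')) (inverse g * (g * inverse g'))"
    by (intro agree_mult agree_sym[OF assms(4)] agree_refl)
  ultimately have "agree n (inverse g) (inverse g')" by (simp only:)
  then show ?thesis using assms by (simp add: fps2_divide agree_mult)
qed

lemma subst_pow_0_0 [simp]: "0 < r \<Longrightarrow> subst_pow r f $ 0 $ 0 = f $ 0 $ 0"
  by (simp add: subst_pow_nth)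

lemma A_equation_unique:
  assumes "A $ 0 $ 0 = 0" "A_equation A" "A' $ 0 $ 0 = 0" "A_equation A'"
  shows "A = A'"
proof -
  have "agree n A A'" for n
  proof (induction n)
    case (Suc n)
    have s: "agree n (subst_pow 2 A) (subst_pow 2 A')" using Suc by (intro agree_subst_pow) simp_all
    have "agree n (A\<^sup>2 / (1 - A) + (1 + A) * subst_pow 2 A / (1 - subst_pow 2 A))
      (A'\<^sup>2 / (1 - A') + (1 + A') * subst_pow 2 A' / (1 - subst_pow 2 A'))"
      unfolding power2_eq_square using assms(1,3)
      by (intro agree_add agree_divide agree_mult agree_diff agree_refl Suc s) simp_all
    then have "agree (Suc n) (var_y + const2 (1/2) * (var_x * (A\<^sup>2 / (1 - A) + (1 + A) * subst_pow 2 A / (1 - subst_pow 2 A))))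
      (var_y + const2 (1/2) * (var_x * (A'\<^sup>2 / (1 - A') + (1 + A') * subst_pow 2 A' / (1 - subst_pow 2 A'))))"
      by (rule agree_add[OF agree_refl agree_mult[OF agree_refl agree_var_x_mult]])
    then show ?case
      using assms(2,4) unfolding A_equation_def mult.assoc by (metis (no_types, lifting))
  qed (simp add: agree_def)
  then show ?thesis unfolding agree_def by (meson fps_ext lessI)
qed

section \<open>Normal trees and the equation of A\<close>

definition normal_trees :: "ptree set" where
  "normal_trees = {t. valid [t] \<and> nf [t] = [t]}"

definition tree_weight :: "ptree \<Rightarrow> weight" where
  "tree_weight t = (nodes [t], leaves [t])"

lemma list_weight_tree_weight: "list_weight tree_weight xs = (nodes xs, leaves xs)"
proof (induction xs)
  case (Cons x xs)
  then show ?case using nodes_append[of "[x]" xs] leaves_append[of "[x]" xs] by (simp add: tree_weight_def)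
qed (simp add: zero_prod_def)

lemma set_normal_trees: "set xs \<subseteq> normal_trees \<longleftrightarrow> valid xs \<and> nf xs = xs"
proof (induction xs)
  case (Cons x xs)
  have "valid (x # xs) \<longleftrightarrow> valid [x] \<and> valid xs" "nf (x # xs) = nf [x] @ nf xs"
    using valid_append[of "[x]" xs] nf_append[of "[x]" xs] by simp_all
  moreover have "nf [x] @ nf xs = x # xs \<longleftrightarrow> nf [x] = [x] \<and> nf xs = xs"
    using length_nf[of "[x]"] by (cases "nf [x]") auto
  ultimately show ?case using Cons by (auto simp: normal_trees_def)
qed simp

lemma finite_fibres_normal_words: "finite_fibres (list_weight tree_weight) {xs. set xs \<subseteq> normal_trees}"
  unfolding finite_fibres_def
proof
  fix c :: weight
  have "{xs \<in> {xs. set xs \<subseteq> normal_trees}. list_weight tree_weight xs = c} \<subseteq>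
    {xs. valid xs \<and> leaves xs \<le> snd c \<and> nodes xs \<le> fst c}"
    by (auto simp: list_weight_tree_weight set_normal_trees)
  then show "finite {xs \<in> {xs. set xs \<subseteq> normal_trees}. list_weight tree_weight xs = c}"
    using finite_valid_bounded finite_subset by blast
qed

lemma finite_fibres_normal_trees: "finite_fibres tree_weight normal_trees"
  unfolding finite_fibres_def
proof
  fix c :: weight
  have "(\<lambda>t. [t]) ` {t \<in> normal_trees. tree_weight t = c} \<subseteq>
    {xs \<in> {xs. set xs \<subseteq> normal_trees}. list_weight tree_weight xs = c}" by auto
  then have "finite ((\<lambda>t. [t]) ` {t \<in> normal_trees. tree_weight t = c})"
    using finite_fibresD[OF finite_fibres_normal_words] finite_subset by blast
  then show "finite {t \<in> normal_trees. tree_weight t = c}"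
    by (rule finite_imageD) (simp add: inj_on_def)
qed

abbreviation A_gf :: fps2 where "A_gf \<equiv> gf tree_weight normal_trees"

definition long_words :: "ptree list set" where
  "long_words = {xs. set xs \<subseteq> normal_trees \<and> 2 \<le> length xs}"

lemma finite_fibres_long_words: "T \<subseteq> long_words \<Longrightarrow> finite_fibres (list_weight tree_weight) T"
  by (rule finite_fibres_subset[OF finite_fibres_normal_words]) (auto simp: long_words_def)

text \<open>The geometric series as a linear equation: a word of length at least 2 has length 2 or
  is a letter in front of another such word.\<close>

lemma gf_long_words:
  "gf (list_weight tree_weight) long_words = A_gf\<^sup>2 + A_gf * gf (list_weight tree_weight) long_words"
proof -
  let ?lw = "list_weight tree_weight" and ?T = "(\<lambda>(x, xs). x # xs) ` (normal_trees \<times> long_words)"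
  have split: "long_words = words normal_trees 2 \<union> ?T"
  proof
    show "long_words \<subseteq> words normal_trees 2 \<union> ?T"
    proof
      fix xs assume xs: "xs \<in> long_words"
      then obtain y ys where ys: "xs = y # ys" by (cases xs) (auto simp: long_words_def)
      show "xs \<in> words normal_trees 2 \<union> ?T"
      proof (cases "length xs = 2")
        case False
        then have "ys \<in> long_words" "y \<in> normal_trees" using xs by (auto simp: long_words_def ys)
        then show ?thesis by (auto simp: ys)
      qed (use xs in \<open>auto simp: words_def long_words_def\<close>)
    qed
  qed (auto simp: words_def long_words_def)
  have "words normal_trees 2 \<inter> ?T = {}" by (auto simp: words_def long_words_def)
  moreover have "words normal_trees 2 \<subseteq> long_words" "?T \<subseteq> long_words" using split by blast+
  ultimately have "gf ?lw long_words = gf ?lw (words normal_trees 2) + gf ?lw ?T"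
    by (subst split) (intro gf_disjoint_Un finite_fibres_long_words)
  moreover have "gf ?lw ?T = gf (\<lambda>(x, xs). tree_weight x + ?lw xs) (normal_trees \<times> long_words)"
    by (rule gf_bij_betw[of "\<lambda>(x, xs). x # xs"]) (auto simp: bij_betw_def inj_on_def)
  ultimately show ?thesis
    using gf_words[OF finite_fibres_normal_trees, of 2]
      gf_times[OF finite_fibres_normal_trees finite_fibres_long_words[OF order_refl]] by simp
qed

definition long_palindromes :: "ptree list set" where
  "long_palindromes = {xs \<in> long_words. rev xs = xs}"

text \<open>Lengths 2 and 3 give the term with 1 + A; every longer palindrome is a shorter one of
  length at least 2 between two equal letters.\<close>

lemma gf_long_palindromes:
  "gf (list_weight tree_weight) long_palindromes = 
    (1 + A_gf) * subst_pow 2 A_gf + subst_pow 2 A_gf * gf (list_weight tree_weight) long_palindromes"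
proof -
  let ?lw = "list_weight tree_weight"
    and ?T = "(\<lambda>(x, xs). x # xs @ [x]) ` (normal_trees \<times> long_palindromes)"
    and ?P = "palindromes normal_trees"
  have union: "long_palindromes = (\<Union>k\<in>{2..}. ?P k)"
    by (auto simp: long_palindromes_def long_words_def palindromes_def words_def)
  have "?T = (\<Union>k\<in>{2..}. (\<lambda>(x, xs). x # xs @ [x]) ` (normal_trees \<times> ?P k))"
    unfolding union by blast
  also have "\<dots> = (\<Union>k\<in>{2..}. ?P (Suc (Suc k)))"
    using bij_betw_palindromes[of normal_trees] by (simp add: bij_betw_def)
  finally have T: "?T = (\<Union>k\<in>{2..}. ?P (Suc (Suc k)))" .
  have "\<exists>j\<ge>2. k = Suc (Suc j)" if "2 \<le> k" "k \<noteq> 2" "k \<noteq> 3" for k :: nat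
    using that by (intro exI[of _ "k - 2"]) auto
  then have eq: "{2 :: nat..} = {2, 3} \<union> (\<lambda>k. Suc (Suc k)) ` {2..}" (is "_ = ?K") by (auto simp: image_iff)
  have "long_palindromes = (\<Union>k\<in>?K. ?P k)" by (subst eq[symmetric]) (rule union)
  then have split: "long_palindromes = ?P 2 \<union> (?P 3 \<union> ?T)" unfolding T by (simp add: Un_assoc)
  then have sub: "?P 2 \<subseteq> long_words" "?P 3 \<subseteq> long_words" "?T \<subseteq> long_words"
    "?P 3 \<union> ?T \<subseteq> long_words"
    unfolding long_palindromes_def by blast+
  have not_T: "xs \<notin> ?T" if "xs \<in> ?P k" "k < 4" for xs k
  proof
    assume "xs \<in> ?T"
    then have "4 \<le> length xs" by (auto simp: long_palindromes_def long_words_def)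
    then show False using that by (simp add: palindromes_def words_def)
  qed
  have "?P 2 \<inter> ?P 3 = {}" by (auto simp: palindromes_def words_def)
  then have disj: "?P 2 \<inter> (?P 3 \<union> ?T) = {}" "?P 3 \<inter> ?T = {}"
    using not_T[of _ 2] not_T[of _ 3] by (simp_all add: disjoint_iff)
  have "gf ?lw long_palindromes = gf ?lw (?P 2) + (gf ?lw (?P 3) + gf ?lw ?T)"
    by (subst split) (simp only: gf_disjoint_Un finite_fibres_long_words sub disj)
  moreover have "gf ?lw ?T = gf (\<lambda>(x, xs). scale_weight 2 (tree_weight x) + ?lw xs) (normal_trees \<times> long_palindromes)"
    by (rule gf_bij_betw[of "\<lambda>(x, xs). x # xs @ [x]"])
      (auto simp: bij_betw_def inj_on_def scale_weight_def prod_eq_iff)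
  moreover have "\<dots> = subst_pow 2 A_gf * gf ?lw long_palindromes"
    using gf_times[OF finite_fibres_scale[OF _ finite_fibres_normal_trees, of 2] finite_fibres_long_words[of long_palindromes]]
    by (simp add: gf_scale long_palindromes_def)
  ultimately show ?thesis
    using gf_palindromes[OF finite_fibres_normal_trees, of 2] gf_palindromes[OF finite_fibres_normal_trees, of 3]
    by (simp add: algebra_simps)
qed

definition canonical_words :: "ptree list set" where
  "canonical_words = {xs \<in> long_words. canon xs = xs}"

text \<open>Every word is canonical or the reversal of a canonical one, and it is both exactly if it
  is a palindrome. This is the origin of the factor 1/2 in the equation of A.\<close>

lemma gf_canonical_words:
  "2 * gf (list_weight tree_weight) canonical_words =
    gf (list_weight tree_weight) long_words + gf (list_weight tree_weight) long_palindromes"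
proof -
  let ?lw = "list_weight tree_weight"
  have canon_fixed: "canon xs = xs \<longleftrightarrow> to_nat xs \<le> to_nat (rev xs)" for xs
    by (auto simp: canon_def)
  have rev_mem: "rev xs \<in> long_words \<longleftrightarrow> xs \<in> long_words" for xs by (simp add: long_words_def)
  have rev_image: "xs \<in> rev ` canonical_words \<longleftrightarrow> xs \<in> long_words \<and> to_nat (rev xs) \<le> to_nat xs" for xs
  proof
    assume "xs \<in> long_words \<and> to_nat (rev xs) \<le> to_nat xs"
    then show "xs \<in> rev ` canonical_words"
      by (intro image_eqI[of _ _ "rev xs"]) (auto simp: canonical_words_def canon_fixed rev_mem)
  qed (auto simp: canonical_words_def canon_fixed rev_mem)
  have "canonical_words \<union> rev ` canonical_words = long_words"
    using rev_image by (auto simp: canonical_words_def canon_fixed)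
  moreover have "canonical_words \<inter> rev ` canonical_words = long_palindromes"
    using rev_image by (auto simp: canonical_words_def canon_fixed long_palindromes_def intro: antisym)
  moreover have "gf ?lw (rev ` canonical_words) = gf ?lw canonical_words"
    by (rule gf_bij_betw[of rev]) (auto simp: bij_betw_def)
  moreover have "finite_fibres ?lw canonical_words" "finite_fibres ?lw (rev ` canonical_words)"
    using rev_image by (auto simp: canonical_words_def intro!: finite_fibres_long_words)
  ultimately show ?thesis using gf_Un_Int[of ?lw canonical_words "rev ` canonical_words"] by simp
qed

lemma gf_singleton: "w s = (0, j) \<Longrightarrow> gf w {s} = var_y ^ j"
proof (rule fps2_eqI)
  fix m n assume "w s = (0, j)"
  then have "{t \<in> {s}. w t = (m, n)} = (if m = 0 \<and> n = j then {s} else {})" by auto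
  then show "gf w {s} $ m $ n = var_y ^ j $ m $ n"
    by (simp add: gf_nth var_y_def fps_const_power)
qed

lemma gf_var_x: "(\<And>s. s \<in> S \<Longrightarrow> v s = (1, 0) + w s) \<Longrightarrow> gf v S = var_x * gf w S"
proof (rule fps2_eqI)
  fix m n assume v: "\<And>s. s \<in> S \<Longrightarrow> v s = (1, 0) + w s"
  have "{s \<in> S. v s = (m, n)} = (if m = 0 then {} else {s \<in> S. w s = (m - 1, n)})"
    by (auto simp: v plus_prod_def prod_eq_iff)
  then show "gf v S $ m $ n = (var_x * gf w S) $ m $ n" by (simp add: gf_nth var_x_def)
qed

lemma normal_trees_eq: "normal_trees = {Leaf} \<union> Node ` canonical_words"
proof -
  have "t \<in> normal_trees \<longleftrightarrow> t \<in> {Leaf} \<union> Node ` canonical_words" for t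
  proof (cases t)
    case (Node us)
    have "t \<in> normal_trees \<longleftrightarrow> 2 \<le> length us \<and> valid us \<and> nf us = us \<and> canon us = us"
      unfolding normal_trees_def Node mem_Collect_eq nf_Node_fixed by auto
    then show ?thesis by (auto simp: Node canonical_words_def long_words_def set_normal_trees)
  qed (simp add: normal_trees_def)
  then show ?thesis by blast
qed

lemma gf_inner_trees: "gf tree_weight (Node ` canonical_words) = A_gf - var_y"
  and A_gf_canonical_words: "A_gf = var_y + var_x * gf (list_weight tree_weight) canonical_words"
proof -
  have "finite_fibres tree_weight (Node ` canonical_words)" "finite_fibres tree_weight {Leaf}"
    by (rule finite_fibres_subset[OF finite_fibres_normal_trees], use normal_trees_eq in blast)+
  then have "A_gf = gf tree_weight {Leaf} + gf tree_weight (Node ` canonical_words)"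
    unfolding normal_trees_eq by (intro gf_disjoint_Un) auto
  then have *: "A_gf = var_y + gf tree_weight (Node ` canonical_words)"
    using gf_singleton[of tree_weight Leaf 1] by (simp add: tree_weight_def)
  then show "gf tree_weight (Node ` canonical_words) = A_gf - var_y" by simp
  have "gf tree_weight (Node ` canonical_words) = gf (\<lambda>us. tree_weight (Node us)) canonical_words"
    by (rule gf_bij_betw[of Node]) (auto simp: bij_betw_def inj_on_def)
  also have "\<dots> = var_x * gf (list_weight tree_weight) canonical_words"
    by (rule gf_var_x) (simp add: tree_weight_def list_weight_tree_weight)
  finally show "A_gf = var_y + var_x * gf (list_weight tree_weight) canonical_words" using * by simp
qed

lemma A_gf_0_0: "A_gf $ 0 $ 0 = 0"
proof -
  have "leaves [t] \<noteq> 0" if "t \<in> normal_trees" for t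
    using that length_le_leaves[of "[t]"] by (auto simp: normal_trees_def)
  then have "{t \<in> normal_trees. tree_weight t = (0, 0)} = {}" by (auto simp: tree_weight_def)
  then show ?thesis by (simp only: gf_nth card.empty of_nat_0)
qed

lemma A_equation_A_gf: "A_equation A_gf"
proof -
  let ?lw = "list_weight tree_weight"
  have e1: "A_gf\<^sup>2 / (1 - A_gf) = gf ?lw long_words"
    by (rule fps2_divide_eqI) (use gf_long_words A_gf_0_0 in \<open>simp_all add: algebra_simps\<close>)
  have e2: "(1 + A_gf) * subst_pow 2 A_gf / (1 - subst_pow 2 A_gf) = gf ?lw long_palindromes"
    by (rule fps2_divide_eqI) (use gf_long_palindromes A_gf_0_0 in \<open>simp_all add: algebra_simps\<close>)
  have "const2 (1/2) * (2 * f) = f" for f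
  proof -
    have "const2 (1/2) * 2 = 1"
      using const2_simps(1)[of "1/2" 2] const2_simps(3) by (simp add: const2_def numeral_fps_const)
    then show ?thesis by (metis mult.assoc mult_1)
  qed
  then have e3: "var_x * gf ?lw canonical_words = const2 (1/2) * var_x * (gf ?lw long_words + gf ?lw long_palindromes)"
    unfolding gf_canonical_words[symmetric] by (metis mult.assoc mult.left_commute)
  show ?thesis
    unfolding A_equation_def by (simp only: e1 e2 e3[symmetric] A_gf_canonical_words[symmetric])
qed

section \<open>The coefficients of B and C\<close>

lemma B_series_nth: "B_series A_gf $ Suc m $ N = of_nat (card (cell_classes N m))"
proof -
  let ?X = "\<lambda>k. {xs \<in> words normal_trees k. list_weight tree_weight xs = (m, N)}"
  let ?c = "\<lambda>k. cycle_index_dihedral k (\<lambda>r. subst_pow r A_gf) $ m $ N"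
  have c: "?c k = of_nat (card (dihedral_orbit ` ?X k))" if "3 \<le> k" for k
    using that by (intro cycle_index_dihedral_nth finite_fibres_normal_trees) simp
  have X: "xs \<in> ?X k \<longleftrightarrow> valid xs \<and> nf xs = xs \<and> length xs = k \<and> leaves xs = N \<and> nodes xs = m" for xs k
    by (auto simp: words_def set_normal_trees list_weight_tree_weight)
  \<comment> \<open>Each branch has at least one leaf, so a cell has at most \<open>N\<close>
    branches and the formal sum is finite at this coefficient.\<close>
  have "?X k = {}" if "N < k" for k
  proof -
    have "xs \<notin> ?X k" for xs
      using that length_le_leaves[of xs] unfolding X by auto
    then show ?thesis by blast
  qed
  then have c0: "?c k = 0" if "3 \<le> k" "N < k" for k
    unfolding c[OF that(1)] using that(2) by (simp only: image_empty card.empty of_nat_0)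
  have "B_series A_gf $ Suc m $ N = (\<Sum>k | k \<in> {3..} \<and> ?c k \<noteq> 0. ?c k)"
    by (simp add: B_series_def formal_sum_def var_x_def)
  also have "\<dots> = (\<Sum>k = 3..N. ?c k)"
  proof (rule sum.mono_neutral_left)
    show "{k. k \<in> {3..} \<and> ?c k \<noteq> 0} \<subseteq> {3..N}"
    proof
      fix k assume "k \<in> {k. k \<in> {3..} \<and> ?c k \<noteq> 0}"
      then show "k \<in> {3..N}" using c0[of k] by (cases "N < k") auto
    qed
    show "\<forall>k\<in>{3..N} - {k. k \<in> {3..} \<and> ?c k \<noteq> 0}. ?c k = 0" by simp
  qed simp
  also have "\<dots> = of_nat (\<Sum>k = 3..N. card (dihedral_orbit ` ?X k))"
    using c by (simp add: of_nat_sum)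
  also have "(\<Sum>k = 3..N. card (dihedral_orbit ` ?X k)) = card (\<Union>k\<in>{3..N}. dihedral_orbit ` ?X k)"
  proof (rule card_UN_disjoint[symmetric])
    show "\<forall>k\<in>{3..N}. finite (dihedral_orbit ` ?X k)"
      using finite_fibresD[OF finite_fibres_words[OF finite_fibres_normal_trees]] by blast
    \<comment> \<open>An orbit determines the length of its lists, so different k contribute
      disjoint sets of orbits.\<close>
    have "xs \<notin> ?X l" if "ys \<in> ?X k" "k \<noteq> l" "dihedral_orbit xs = dihedral_orbit ys" for xs ys k l
    proof -
      have "xs \<in> dihedral_orbit ys" using that(3) dihedral_orbit_refl by blast
      then have "length xs = length ys" by (auto simp: dihedral_orbit_def)
      then show ?thesis using that X by auto
    qed
    then show "\<forall>k\<in>{3..N}. \<forall>l\<in>{3..N}. k \<noteq> l \<longrightarrow> dihedral_orbit ` ?X k \<inter> dihedral_orbit ` ?X l = {}"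
      by blast
  qed simp
  also have "(\<Union>k\<in>{3..N}. dihedral_orbit ` ?X k) = cell_classes N m"
  proof -
    have "(\<Union>k\<in>{3..N}. ?X k) = {xs \<in> cells N m. nf xs = xs}"
    proof (rule set_eqI)
      fix xs
      have "xs \<in> (\<Union>k\<in>{3..N}. ?X k) \<longleftrightarrow>
        (\<exists>k\<in>{3..N}. valid xs \<and> nf xs = xs \<and> length xs = k \<and> leaves xs = N \<and> nodes xs = m)"
        unfolding UN_iff X ..
      also have "\<dots> \<longleftrightarrow> xs \<in> {xs \<in> cells N m. nf xs = xs}"
        using length_le_leaves[of xs] by (auto simp: cells_def cell_def)
      finally show "xs \<in> (\<Union>k\<in>{3..N}. ?X k) \<longleftrightarrow> xs \<in> {xs \<in> cells N m. nf xs = xs}" .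
    qed
    then show ?thesis unfolding cell_classes_def by blast
  qed
  finally show ?thesis .
qed

text \<open>Ordered pairs of inner trees are split by comparing keys. Swapping matches the two
  strict parts, and the pairs of equal trees have doubled weight. Removing y and its square discards
  the leaf, which is a side and no diagonal.\<close>

lemma C_series_nth: "C_series A_gf $ Suc m $ N = of_nat (card (edge_pairs N m))"
proof -
  let ?I = "Node ` canonical_words" and ?w = "\<lambda>(s, t). tree_weight s + tree_weight t"
  let ?E = "{p \<in> ?I \<times> ?I. key (fst p) < key (snd p)}"
    and ?E' = "{p \<in> ?I \<times> ?I. key (snd p) < key (fst p)}"
    and ?D = "(\<lambda>s. (s, s)) ` ?I"
  have ffI: "finite_fibres tree_weight ?I"
    by (rule finite_fibres_subset[OF finite_fibres_normal_trees]) (use normal_trees_eq in blast)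
  note ff = finite_fibres_times[OF ffI ffI]
  have ff': "finite_fibres ?w T" if "T \<subseteq> ?I \<times> ?I" for T using ff that by (rule finite_fibres_subset)
  have "?I \<times> ?I = ?E \<union> (?E' \<union> ?D)"
  proof -
    have "p \<in> ?E \<union> (?E' \<union> ?D)" if p: "p \<in> ?I \<times> ?I" for p
    proof -
      consider "key (fst p) < key (snd p)" | "key (snd p) < key (fst p)" | "fst p = snd p"
        by (metis key_eq_iff linorder_less_linear)
      then show ?thesis
      proof cases
        case 3
        then have "p = (fst p, fst p)" by (simp add: prod_eq_iff)
        moreover have "fst p \<in> ?I" using p by (simp add: mem_Times_iff)
        ultimately have "p \<in> ?D" by (rule image_eqI)
        then show ?thesis by blast
      qed (use p in blast)+
    qed
    then show ?thesis by blast
  qed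
  then have "gf ?w (?I \<times> ?I) = gf ?w (?E \<union> (?E' \<union> ?D))" by simp
  also have "\<dots> = gf ?w ?E + gf ?w (?E' \<union> ?D)"
    by (rule gf_disjoint_Un; (rule ff')?) auto
  also have "gf ?w (?E' \<union> ?D) = gf ?w ?E' + gf ?w ?D"
    by (rule gf_disjoint_Un; (rule ff')?) auto
  also have "gf ?w ?E' = gf ?w ?E"
    by (rule gf_bij_betw[of prod.swap]) (auto simp: bij_betw_def inj_on_def add.commute image_iff)
  also have "gf ?w ?D = gf (\<lambda>s. scale_weight 2 (tree_weight s)) ?I"
    by (rule gf_bij_betw[of "\<lambda>s. (s, s)"]) (auto simp: bij_betw_def inj_on_def scale_weight_def prod_eq_iff)
  also have "\<dots> = subst_pow 2 A_gf - var_y\<^sup>2"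
  proof -
    have "finite_fibres (\<lambda>s. scale_weight 2 (tree_weight s)) normal_trees"
      by (rule finite_fibres_scale[OF _ finite_fibres_normal_trees]) simp
    then have "finite_fibres (\<lambda>s. scale_weight 2 (tree_weight s)) ?I"
      "finite_fibres (\<lambda>s. scale_weight 2 (tree_weight s)) {Leaf}"
      by (rule finite_fibres_subset, use normal_trees_eq in blast)+
    then have "gf (\<lambda>s. scale_weight 2 (tree_weight s)) normal_trees =
      gf (\<lambda>s. scale_weight 2 (tree_weight s)) {Leaf} + gf (\<lambda>s. scale_weight 2 (tree_weight s)) ?I"
      unfolding normal_trees_eq by (intro gf_disjoint_Un) auto
    moreover have "gf (\<lambda>s. scale_weight 2 (tree_weight s)) {Leaf} = var_y\<^sup>2"
      by (rule gf_singleton) (simp add: scale_weight_def tree_weight_def)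
    ultimately show ?thesis by (simp add: gf_scale)
  qed
  finally have "(A_gf - var_y)\<^sup>2 - (subst_pow 2 A_gf - var_y\<^sup>2) = gf ?w ?E + gf ?w ?E"
    unfolding gf_times[OF ffI ffI] gf_inner_trees power2_eq_square by (simp add: algebra_simps)
  then have "C_series A_gf $ Suc m $ N = gf ?w ?E $ Suc m $ N"
    by (simp only: C_series_def const2_mult_nth fps_add_nth) simp
  moreover have "bij_betw (\<lambda>(ps, us). (Node ps, Node us)) (edge_pairs N m) {p \<in> ?E. ?w p = (Suc m, N)}"
  proof -
    have "(ps, us) \<in> edge_pairs N m \<longleftrightarrow> (Node ps, Node us) \<in> {p \<in> ?E. ?w p = (Suc m, N)}" for ps us
    proof -
      have "valid [Node ps, Node us] \<and> nf [Node ps, Node us] = [Node ps, Node us] \<longleftrightarrow>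
        Node ps \<in> normal_trees \<and> Node us \<in> normal_trees"
        using set_normal_trees[of "[Node ps, Node us]"] by simp
      then show ?thesis
        unfolding edge_pairs_def normal_trees_eq tree_weight_def by auto
    qed
    then show ?thesis by (auto simp: bij_betw_def inj_on_def image_iff)
  qed
  ultimately show ?thesis using bij_betw_same_card by (fastforce simp: gf_nth)
qed

theorem theorem3p3p1:
  shows "(\<exists>!A. A $ 0 $ 0 = 0 \<and> A_equation A) \<and>
    (\<forall>A. A $ 0 $ 0 = 0 \<and> A_equation A \<longrightarrow>
      (\<forall>n k. 2 \<le> n \<longrightarrow> k \<le> n - 2 \<longrightarrow>
        of_nat (card (face_classes n k)) = F_series A $ (k + 1) $ (n + 1)))"
proof -
  have unique: "A = A_gf" if "A $ 0 $ 0 = 0" "A_equation A" for A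
    using A_equation_unique that A_gf_0_0 A_equation_A_gf by blast
  have "of_nat (card (face_classes n k)) = F_series A_gf $ (k + 1) $ (n + 1)" if "2 \<le> n" for n k
  proof -
    have "F_series A_gf $ (k + 1) $ (n + 1) =
        of_nat (card (cell_classes (n + 1) k)) - of_nat (card (edge_pairs (n + 1) k))"
      by (simp only: F_series_def fps_sub_nth Suc_eq_plus1[symmetric] B_series_nth C_series_nth)
    \<comment> \<open>The count is a sum of natural numbers; the difference is formed among
      rationals, where nothing is truncated.\<close>
    also have "\<dots> = of_nat (card (face_classes n k))"
      using card_face_classes[OF that, of k] by (metis add_diff_cancel_right' of_nat_add)
    finally show ?thesis by simp
  qed
  then show ?thesis using unique A_gf_0_0 A_equation_A_gf by blast
qed

end
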